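(* Consider any one of the planar viscoelastic systems $V_t+G(V)_z=(B(V)V_z)_z$ listed in the context, $V=(a,b)\in\mathbb{R}^{n}\times\mathbb{R}^n$, and a viscous shock profile $\bar V$ of it with endstates $V_\pm=(a_\pm,b_\pm)$, such that (i) $V_-$ and $V_+$ lie in the region of strict hyperbolicity of $DG$, and (ii) the profile $\{\bar V(\cdot)\}$ lies in a region where the chosen viscosity matrix $B_0$ is uniformly elliptic. Then the system and profile belong to the class of symmetrizable hyperbolic--parabolic systems and profiles, in the following sense. There is a smooth matrix field $\tilde A^0(V)=\begin{pmatrix}Q(V)&0\\0&\mathrm{Id}_n\end{pmatrix}$, with $Q(V)\in\mathbb{R}^{n\times n}$ symmetric positive definite everywhere and $\tilde A^0=(D^2\eta)^{-1}$ (equivalently $Q=(D^2W(a))^{-1}$) in neighborhoods of $V_-$ and $V_+$, such that, with $\tilde A=DG\,\tilde A^0$ and $\tilde B=B\,\tilde A^0$: (A1) $\tilde A(V_-)$ and $\tilde A(V_+)$ are symmetric; $\tilde A^0$ is symmetric and positive definite everywhere; and the upper left $n\times n$ block of $\tilde A$ (corresponding to the purely hyperbolic part of the system) is symmetric everywhere. (A2) No eigenvector of $DG(V_\pm)$ belongs to the kernel of $B(V_\pm)$. (A3) $\tilde B=\begin{pmatrix}0&0\\0&B_0\end{pmatrix}$, and the symmetric part of $B_0$ is uniformly elliptic on the region containing the profile. Moreover, for the full system ($n=3$), $B_0=\frac1{a_3}\mathrm{diag}(1,1,2)$ is uniformly elliptic in any region of the form $0<a_3<C$, and $B_0=\mathrm{diag}(1,1,0)+2a\otimes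 a$ is uniformly elliptic in any region of the form $a_3^2>c(1+a_1^2+a_2^2)$, where $c,C>0$ are constants.
   Context: Systems. For $n\in\{1,2,3\}$ write $V=(a,b)\in\mathbb{R}^n\times\mathbb{R}^n$ and $$G(V)=(-b,-DW(a)),\qquad DG(V)=\begin{pmatrix}0&-\mathrm{Id}_n\\-M&0\end{pmatrix},\quad M=D^2W(a),\qquad B(V)=\begin{pmatrix}0&0\\0&B_0(a)\end{pmatrix},$$ with entropy $\eta(V)=\frac12|b|^2+W(a)$. The planar systems are: (1) (3D compressible) $n=3$, $a=(a_1,a_2,a_3)$, $a_3>0$, $W(a)=\frac14(|a|^2-1)^2+\frac12(a_1^2+a_2^2)$, with $B_0=\mathrm{diag}(1,1,0)+2a\otimes a$ or $B_0=\frac1{a_3}\mathrm{diag}(1,1,2)$; (2) (2D incompressible shear) $n=2$, $a=(a_1,a_2)$, $W(a)=\frac14|a|^4+\frac12|a|^2$, with $B_0=\mathrm{Id}_2+2a\otimes a$ or $B_0=\mathrm{Id}_2$; (3) (2D compressible) $n=2$, $a=(a_2,a_3)$, $a_3>0$, $W(a)=\frac14(|a|^2-1)^2+\frac12a_2^2$, with $B_0=\mathrm{diag}(1,0)+2a\otimes a$ or $B_0=\frac1{a_3}\mathrm{diag}(1,2)$; (4) (1D transverse) $n=1$, $a=a_1$, $W(a)=\frac14a_1^4+\frac12a_1^2$, $B_0=1$; (5) (1D compressible) $n=1$, $a=a_3>0$, $W(a)=\frac14(a_3^2-1)^2$, $B_0=2/a_3$. A viscous shock profile with speed $s$ is a traveling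 wave solution $V(z,t)=\bar V(z-st)$ with $\lim_{z\to\pm\infty}\bar V(z)=V_\pm$. The region of strict hyperbolicity of $DG$ is the set of $V$ at which $DG(V)$ has $2n$ distinct real eigenvalues (equivalently $M$ has $n$ distinct positive eigenvalues). $B_0$ is uniformly elliptic on a set if there is $\theta>0$ with $x^TB_0(a)x\ge\theta|x|^2$ for all $x\in\mathbb{R}^n$ and all $a$ in the set. *)

theory Defs
  imports "HOL-Analysis.Analysis"
begin

section \<open>Calculus\<close>

text \<open>Classes \<open>C\<^sup>k\<close> and \<open>C\<^sup>\<infinity>\<close> on an open set, by iterated Frechet derivatives in
  arbitrary directions.\<close>

primrec Ck_on :: "nat \<Rightarrow> 'a::real_normed_vector set \<Rightarrow> ('a \<Rightarrow> 'b::real_normed_vector) \<Rightarrow> bool" where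
  "Ck_on 0 S f \<longleftrightarrow> continuous_on S f"
| "Ck_on (Suc k) S f \<longleftrightarrow>
     (\<forall>x\<in>S. f differentiable (at x)) \<and> (\<forall>v. Ck_on k S (\<lambda>x. frechet_derivative f (at x) v))"

definition smooth_on :: "'a::real_normed_vector set \<Rightarrow> ('a \<Rightarrow> 'b::real_normed_vector) \<Rightarrow> bool" where
  "smooth_on S f \<longleftrightarrow> open S \<and> (\<forall>k. Ck_on k S f)"

definition gradient :: "(real^'n \<Rightarrow> real) \<Rightarrow> real^'n \<Rightarrow> real^'n" where
  "gradient f x = (\<chi> i. frechet_derivative f (at x) (axis i 1))"

definition hessian :: "(real^'n \<Rightarrow> real) \<Rightarrow> real^'n \<Rightarrow> real^'n^'n" where
  "hessian f x = jacobian (gradient f) (at x)"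

section \<open>Matrices\<close>

definition diag_mat :: "real^'n \<Rightarrow> real^'n^'n" where
  "diag_mat d = (\<chi> i j. if i = j then d $ i else 0)"

definition outer :: "real^'n \<Rightarrow> real^'n \<Rightarrow> real^'n^'n" where
  "outer x y = (\<chi> i j. x $ i * y $ j)"

definition symmetric_mat :: "real^'n^'n \<Rightarrow> bool" where
  "symmetric_mat A \<longleftrightarrow> transpose A = A"

definition sym_pos_def :: "real^'n^'n \<Rightarrow> bool" where
  "sym_pos_def A \<longleftrightarrow> symmetric_mat A \<and> (\<forall>x. x \<noteq> 0 \<longrightarrow> x \<bullet> (A *v x) > 0)"

definition sym_part :: "real^'n^'n \<Rightarrow> real^'n^'n" where
  "sym_part A = (1/2) *\<^sub>R (A + transpose A)"

definition is_eigenvector :: "real^'n^'n \<Rightarrow> real \<Rightarrow> real^'n \<Rightarrow> bool" where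
  "is_eigenvector A l v \<longleftrightarrow> v \<noteq> 0 \<and> A *v v = l *\<^sub>R v"

definition real_eigenvalues :: "real^'n^'n \<Rightarrow> real set" where
  "real_eigenvalues A = {l. \<exists>v. is_eigenvector A l v}"

definition uniformly_elliptic_on :: "(real^'n) set \<Rightarrow> (real^'n \<Rightarrow> real^'n^'n) \<Rightarrow> bool" where
  "uniformly_elliptic_on R B \<longleftrightarrow> (\<exists>\<theta>>0. \<forall>a\<in>R. \<forall>x. x \<bullet> (B a *v x) \<ge> \<theta> * (norm x)\<^sup>2)"

text \<open>A state \<open>V = (a,b) \<in> \<real>\<^sup>n \<times> \<real>\<^sup>n\<close> is a vector indexed by \<open>'n + 'n\<close>,
  with \<open>a\<close> in the \<open>Inl\<close> components and \<open>b\<close> in the \<open>Inr\<close> components, so that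
  \<open>2n \<times> 2n\<close> matrices are ordinary matrices over this index type.\<close>

definition state :: "real^'n \<Rightarrow> real^'n \<Rightarrow> real^('n + 'n)" where
  "state a b = (\<chi> k. case k of Inl i \<Rightarrow> a $ i | Inr i \<Rightarrow> b $ i)"

definition apart :: "real^('n + 'n) \<Rightarrow> real^'n" where
  "apart V = (\<chi> i. V $ Inl i)"

definition bpart :: "real^('n + 'n) \<Rightarrow> real^'n" where
  "bpart V = (\<chi> i. V $ Inr i)"

definition block_mat ::
  "real^'n^'n \<Rightarrow> real^'n^'n \<Rightarrow> real^'n^'n \<Rightarrow> real^'n^'n \<Rightarrow> real^('n + 'n)^('n + 'n)" where
  "block_mat A B C D = (\<chi> k l. case k of
       Inl i \<Rightarrow> (case l of Inl j \<Rightarrow> A $ i $ j | Inr j \<Rightarrow> B $ i $ j)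
     | Inr i \<Rightarrow> (case l of Inl j \<Rightarrow> C $ i $ j | Inr j \<Rightarrow> D $ i $ j))"

definition upper_left :: "real^('n + 'n)^('n + 'n) \<Rightarrow> real^'n^'n" where
  "upper_left A = (\<chi> i j. A $ Inl i $ Inl j)"

section \<open>Planar systems\<close>

text \<open>A system is given by the set of admissible \<open>a\<close>, the potential \<open>W\<close> and the
  viscosity block \<open>B\<^sub>0\<close>. \<open>B\<^sub>0\<close> is meaningful only on \<open>adm\<close>.\<close>

record ('n::finite) planar_system =
  adm :: "(real^'n) set"
  pot :: "real^'n \<Rightarrow> real"
  visc :: "real^'n \<Rightarrow> real^'n^'n"

definition state_space :: "'n::finite planar_system \<Rightarrow> (real^('n + 'n)) set" where
  "state_space S = {V. apart V \<in> adm S}"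

definition flux :: "'n::finite planar_system \<Rightarrow> real^('n + 'n) \<Rightarrow> real^('n + 'n)" where
  "flux S V = state (- bpart V) (- gradient (pot S) (apart V))"

definition Dflux :: "'n::finite planar_system \<Rightarrow> real^('n + 'n) \<Rightarrow> real^('n + 'n)^('n + 'n)" where
  "Dflux S V = jacobian (flux S) (at V)"

definition Bmat :: "'n::finite planar_system \<Rightarrow> real^('n + 'n) \<Rightarrow> real^('n + 'n)^('n + 'n)" where
  "Bmat S V = block_mat 0 0 0 (visc S (apart V))"

definition entropy :: "'n::finite planar_system \<Rightarrow> real^('n + 'n) \<Rightarrow> real" where
  "entropy S V = (1/2) * (norm (bpart V))\<^sup>2 + pot S (apart V)"

text \<open>The Jacobian of the flux has the expected block form wherever \<open>W\<close> is twice
  differentiable, in particular for all models below.\<close>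

lemma Dflux_block:
  fixes S :: "'n::finite planar_system"
  assumes "gradient (pot S) differentiable (at (apart V))"
  shows "Dflux S V = block_mat 0 (- mat 1) (- hessian (pot S) (apart V)) 0"
proof -
  define H where "H = hessian (pot S) (apart V)"
  have lin: "linear (apart :: real^('n+'n) \<Rightarrow> real^'n)" "linear (bpart :: real^('n+'n) \<Rightarrow> real^'n)"
    by (auto intro!: linearI simp: apart_def bpart_def vec_eq_iff)
  have lin_state: "linear (\<lambda>p. state (fst p) (snd p) :: real^('n+'n))"
    by (auto intro!: linearI simp: state_def vec_eq_iff split: sum.splits)
  have a: "(apart has_derivative apart) (at V)" and b: "(bpart has_derivative bpart) (at V)"
    using lin by (auto intro: linear_imp_has_derivative)
  have g: "(gradient (pot S) has_derivative (\<lambda>h. H *v h)) (at (apart V))"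
    using assms unfolding H_def hessian_def jacobian_works by simp
  have "((\<lambda>U. gradient (pot S) (apart U)) has_derivative (\<lambda>h. H *v apart h)) (at V)"
    using has_derivative_compose[OF a g] by simp
  then have p: "((\<lambda>U. (- bpart U, - gradient (pot S) (apart U))) has_derivative
      (\<lambda>h. (- bpart h, - (H *v apart h)))) (at V)"
    by (intro has_derivative_Pair has_derivative_minus b)
  have "((\<lambda>U. state (fst (- bpart U, - gradient (pot S) (apart U)))
                      (snd (- bpart U, - gradient (pot S) (apart U)))) has_derivative
      (\<lambda>h. state (fst (- bpart h, - (H *v apart h))) (snd (- bpart h, - (H *v apart h))))) (at V)"
    by (rule has_derivative_compose[OF p linear_imp_has_derivative[OF lin_state]])
  then have "(flux S has_derivative (\<lambda>h. state (- bpart h) (- (H *v apart h)))) (at V)"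
    by (simp add: flux_def[abs_def])
  then have "Dflux S V = matrix (\<lambda>h. state (- bpart h) (- (H *v apart h)))"
    by (simp add: Dflux_def jacobian_def frechet_derivative_at[symmetric])
  also have "\<dots> = block_mat 0 (- mat 1) (- H) 0"
    by (auto simp: matrix_def block_mat_def state_def apart_def bpart_def vec_eq_iff axis_def
        mat_def matrix_vector_mult_def if_distrib[of "\<lambda>x. _ * x"] cong: if_cong split: sum.splits)
  finally show ?thesis unfolding H_def .
qed

subsection \<open>The five models\<close>

text \<open>3D compressible, \<open>a = (a\<^sub>1,a\<^sub>2,a\<^sub>3)\<close>.\<close>

definition W_3D_comp :: "real^3 \<Rightarrow> real" where
  "W_3D_comp a = (1/4) * ((norm a)\<^sup>2 - 1)\<^sup>2 + (1/2) * ((a$1)\<^sup>2 + (a$2)\<^sup>2)"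

definition B_3D_comp_1 :: "real^3 \<Rightarrow> real^3^3" where
  "B_3D_comp_1 a = diag_mat (vector [1, 1, 0]) + 2 *\<^sub>R outer a a"

definition B_3D_comp_2 :: "real^3 \<Rightarrow> real^3^3" where
  "B_3D_comp_2 a = (1 / a$3) *\<^sub>R diag_mat (vector [1, 1, 2])"

text \<open>2D incompressible shear, \<open>a = (a\<^sub>1,a\<^sub>2)\<close>.\<close>

definition W_2D_shear :: "real^2 \<Rightarrow> real" where
  "W_2D_shear a = (1/4) * (norm a)^4 + (1/2) * (norm a)\<^sup>2"

definition B_2D_shear_1 :: "real^2 \<Rightarrow> real^2^2" where
  "B_2D_shear_1 a = mat 1 + 2 *\<^sub>R outer a a"

definition B_2D_shear_2 :: "real^2 \<Rightarrow> real^2^2" where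
  "B_2D_shear_2 a = mat 1"

text \<open>2D compressible, \<open>a = (a\<^sub>2,a\<^sub>3)\<close>: the component \<open>a\<^sub>2\<close> is \<open>a$1\<close> and \<open>a\<^sub>3\<close> is \<open>a$2\<close>.\<close>

definition W_2D_comp :: "real^2 \<Rightarrow> real" where
  "W_2D_comp a = (1/4) * ((norm a)\<^sup>2 - 1)\<^sup>2 + (1/2) * (a$1)\<^sup>2"

definition B_2D_comp_1 :: "real^2 \<Rightarrow> real^2^2" where
  "B_2D_comp_1 a = diag_mat (vector [1, 0]) + 2 *\<^sub>R outer a a"

definition B_2D_comp_2 :: "real^2 \<Rightarrow> real^2^2" where
  "B_2D_comp_2 a = (1 / a$2) *\<^sub>R diag_mat (vector [1, 2])"

text \<open>1D transverse, \<open>a = a\<^sub>1\<close>.\<close>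

definition W_1D_trans :: "real^1 \<Rightarrow> real" where
  "W_1D_trans a = (1/4) * (a$1)^4 + (1/2) * (a$1)\<^sup>2"

definition B_1D_trans :: "real^1 \<Rightarrow> real^1^1" where
  "B_1D_trans a = mat 1"

text \<open>1D compressible: the only component \<open>a\<^sub>3\<close> is \<open>a$1\<close>.\<close>

definition W_1D_comp :: "real^1 \<Rightarrow> real" where
  "W_1D_comp a = (1/4) * ((a$1)\<^sup>2 - 1)\<^sup>2"

definition B_1D_comp :: "real^1 \<Rightarrow> real^1^1" where
  "B_1D_comp a = mat (2 / a$1)"

definition systems_n3 :: "3 planar_system set" where
  "systems_n3 =
    {\<lparr>adm = {a. a$3 > 0}, pot = W_3D_comp, visc = B_3D_comp_1\<rparr>,
     \<lparr>adm = {a. a$3 > 0}, pot = W_3D_comp, visc = B_3D_comp_2\<rparr>}"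

definition systems_n2 :: "2 planar_system set" where
  "systems_n2 =
    {\<lparr>adm = UNIV, pot = W_2D_shear, visc = B_2D_shear_1\<rparr>,
     \<lparr>adm = UNIV, pot = W_2D_shear, visc = B_2D_shear_2\<rparr>,
     \<lparr>adm = {a. a$2 > 0}, pot = W_2D_comp, visc = B_2D_comp_1\<rparr>,
     \<lparr>adm = {a. a$2 > 0}, pot = W_2D_comp, visc = B_2D_comp_2\<rparr>}"

definition systems_n1 :: "1 planar_system set" where
  "systems_n1 =
    {\<lparr>adm = UNIV, pot = W_1D_trans, visc = B_1D_trans\<rparr>,
     \<lparr>adm = {a. a$1 > 0}, pot = W_1D_comp, visc = B_1D_comp\<rparr>}"

section \<open>Profiles\<close>

text \<open>Classical solutions of \<open>V\<^sub>t + G(V)\<^sub>z = (B(V) V\<^sub>z)\<^sub>z\<close>, with arguments in the order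
  \<open>V z t\<close>. Differentiability of \<open>G(V)\<close> in \<open>z\<close> follows from that of \<open>V\<close>, as \<open>G\<close> is smooth.\<close>

definition classical_solution ::
  "'n::finite planar_system \<Rightarrow> (real \<Rightarrow> real \<Rightarrow> real^('n + 'n)) \<Rightarrow> bool" where
  "classical_solution S V \<longleftrightarrow> (\<forall>z t.
     V z t \<in> state_space S \<and>
     (\<lambda>t. V z t) differentiable (at t) \<and>
     (\<lambda>z. V z t) differentiable (at z) \<and>
     (\<lambda>z. Bmat S (V z t) *v vector_derivative (\<lambda>y. V y t) (at z)) differentiable (at z) \<and>
     vector_derivative (\<lambda>t. V z t) (at t) + vector_derivative (\<lambda>z. flux S (V z t)) (at z)
       = vector_derivative (\<lambda>z. Bmat S (V z t) *v vector_derivative (\<lambda>y. V y t) (at z)) (at z))"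

definition viscous_shock_profile ::
  "'n::finite planar_system \<Rightarrow> real \<Rightarrow> (real \<Rightarrow> real^('n + 'n)) \<Rightarrow>
   real^('n + 'n) \<Rightarrow> real^('n + 'n) \<Rightarrow> bool" where
  "viscous_shock_profile S s Vbar Vm Vp \<longleftrightarrow>
     classical_solution S (\<lambda>z t. Vbar (z - s * t)) \<and>
     (Vbar \<longlongrightarrow> Vm) at_bot \<and> (Vbar \<longlongrightarrow> Vp) at_top"

definition strict_hyperbolicity_region ::
  "'n::finite planar_system \<Rightarrow> (real^('n + 'n)) set" where
  "strict_hyperbolicity_region S =
     {V \<in> state_space S. card (real_eigenvalues (Dflux S V)) = 2 * CARD('n)}"

section \<open>Symmetrizable hyperbolic--parabolic class\<close>

definition cond_A1 ::
  "'n::finite planar_system \<Rightarrow> (real^('n + 'n) \<Rightarrow> real^('n + 'n)^('n + 'n)) \<Rightarrow>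
   real^('n + 'n) \<Rightarrow> real^('n + 'n) \<Rightarrow> bool" where
  "cond_A1 S A0 Vm Vp \<longleftrightarrow>
     symmetric_mat (Dflux S Vm ** A0 Vm) \<and> symmetric_mat (Dflux S Vp ** A0 Vp) \<and>
     (\<forall>V\<in>state_space S. sym_pos_def (A0 V)) \<and>
     (\<forall>V\<in>state_space S. symmetric_mat (upper_left (Dflux S V ** A0 V)))"

definition cond_A2 ::
  "'n::finite planar_system \<Rightarrow> real^('n + 'n) \<Rightarrow> real^('n + 'n) \<Rightarrow> bool" where
  "cond_A2 S Vm Vp \<longleftrightarrow>
     (\<forall>V\<in>{Vm, Vp}. \<not> (\<exists>l v. is_eigenvector (Dflux S V) l v \<and> Bmat S V *v v = 0))"

definition cond_A3 ::
  "'n::finite planar_system \<Rightarrow> (real^('n + 'n) \<Rightarrow> real^('n + 'n)^('n + 'n)) \<Rightarrow>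
   (real^'n) set \<Rightarrow> bool" where
  "cond_A3 S A0 R \<longleftrightarrow>
     (\<forall>V\<in>state_space S. Bmat S V ** A0 V = block_mat 0 0 0 (visc S (apart V))) \<and>
     uniformly_elliptic_on R (\<lambda>a. sym_part (visc S a))"

text \<open>Since \<open>matrix_inv\<close> is unspecified on singular matrices, invertibility is part of
  ``\<open>A\<^sup>0\<close> is the inverse of the Hessian of the entropy''.\<close>

definition symmetrizable_hyperbolic_parabolic ::
  "'n::finite planar_system \<Rightarrow> (real^'n) set \<Rightarrow> real^('n + 'n) \<Rightarrow> real^('n + 'n) \<Rightarrow> bool" where
  "symmetrizable_hyperbolic_parabolic S R Vm Vp \<longleftrightarrow>
     (\<exists>Q A0.
        (\<forall>V. A0 V = block_mat (Q V) 0 0 (mat 1)) \<and>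
        smooth_on (state_space S) A0 \<and>
        (\<forall>V\<in>state_space S. sym_pos_def (Q V)) \<and>
        (\<forall>Ve\<in>{Vm, Vp}. \<forall>\<^sub>F V in nhds Ve.
           invertible (hessian (entropy S) V) \<and> A0 V = matrix_inv (hessian (entropy S) V) \<and>
           invertible (hessian (pot S) (apart V)) \<and> Q V = matrix_inv (hessian (pot S) (apart V))) \<and>
        cond_A1 S A0 Vm Vp \<and> cond_A2 S Vm Vp \<and> cond_A3 S A0 R)"

text \<open>The hypotheses on the profile: \<open>R\<close> is a region of \<open>a\<close>-values containing the profile on
  which the viscosity block is uniformly elliptic.\<close>

definition admissible_profile ::
  "'n::finite planar_system \<Rightarrow> real \<Rightarrow> (real \<Rightarrow> real^('n + 'n)) \<Rightarrow>
   real^('n + 'n) \<Rightarrow> real^('n + 'n) \<Rightarrow> (real^'n) set \<Rightarrow> bool" where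
  "admissible_profile S s Vbar Vm Vp R \<longleftrightarrow>
     viscous_shock_profile S s Vbar Vm Vp \<and>
     Vm \<in> strict_hyperbolicity_region S \<and> Vp \<in> strict_hyperbolicity_region S \<and>
     (\<forall>z. apart (Vbar z) \<in> R) \<and> uniformly_elliptic_on R (visc S)"

end

theory Submission
  imports Defs
begin

text \<open>
  Write \<open>M(a) = D\<^sup>2W(a)\<close>. All five potentials have the form
  \<open>W(a) = (|a|\<^sup>2 - \<kappa>)\<^sup>2/4 + (\<Sum>\<^sub>i p\<^sub>i a\<^sub>i\<^sup>2)/2\<close> with \<open>\<kappa> \<le> 1\<close> and \<open>p\<^sub>i \<ge> 0\<close>, so that
  \<open>M(a) = (|a|\<^sup>2 - \<kappa>) Id + 2 a \<otimes> a + diag p\<close> is polynomial in \<open>a\<close> and \<open>M \<ge> -Id\<close> everywhere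
  (\<open>elastic_system_symmetrizable\<close>).

  At a point of strict hyperbolicity, \<open>M\<close> is positive definite: an eigenvector \<open>(x,y)\<close> of
  \<open>DG\<close> for \<open>l\<close> satisfies \<open>M x = l\<^sup>2 x\<close>, \<open>y = -l x\<close>, so \<open>2n\<close> distinct eigenvalues
  of \<open>DG\<close> force \<open>n\<close> distinct positive eigenvalues of \<open>M\<close>, hence an orthogonal
  eigenbasis (\<open>strictly_hyperbolic_imp_pos_def\<close>). Away from the endstates
  \<open>M\<close> may be indefinite, so \<open>M\<^sup>-\<^sup>1\<close> cannot serve as \<open>Q\<close> globally. Since \<open>M \<ge> -Id\<close>,
  this is repaired by a scalar: there is a smooth \<open>h \<ge> 0\<close> that vanishes near \<open>a\<^sub>-\<close> and \<open>a\<^sub>+\<close>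
  and is at least \<open>2\<close> outside the balls around them on which \<open>M\<close> is positive definite
  (\<open>exists_pos_def_regularization\<close>). Then \<open>Q = (M + h Id)\<^sup>-\<^sup>1\<close> is positive definite
  everywhere, equals \<open>M\<^sup>-\<^sup>1\<close> near the endstates, and is smooth by Cramer's rule
  (\<open>Ck_on_matrix_inv\<close>).

  With \<open>A\<^sup>0 = diag(Q, Id)\<close> the matrix \<open>DG A\<^sup>0\<close> has the blocks \<open>0, -Id, -M Q, 0\<close>, which is
  symmetric where \<open>M Q = Id\<close>, and its upper left block vanishes; this is (A1). For (A2), the uniform ellipticity of \<open>B\<^sub>0\<close>
  along the profile passes to its limits \<open>a\<^sub>-\<close>, \<open>a\<^sub>+\<close> by continuity (\<open>elliptic_at_limit\<close>), so an
  eigenvector in the kernel of \<open>B\<close> would have \<open>y = -l x = 0\<close>, hence \<open>M x = l\<^sup>2 x = 0\<close>, which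
  the positivity of \<open>M\<close> excludes. (A3) is immediate because \<open>A\<^sup>0\<close> is the identity on the
  parabolic block.
\<close>

section \<open>Calculus of \<open>C\<^sup>k\<close> functions\<close>

lemma Ck_on_cong:
  assumes "open S" "\<And>x. x \<in> S \<Longrightarrow> f x = g x"
  shows "Ck_on k S f \<longleftrightarrow> Ck_on k S g"
  using assms(2)
proof (induction k arbitrary: f g)
  case 0
  then show ?case by (simp cong: continuous_on_cong)
next
  case (Suc k)
  have d: "f differentiable (at x) \<longleftrightarrow> g differentiable (at x)" if "x \<in> S" for x
    using Suc.prems has_derivative_transform_within_open[OF _ assms(1) that]
    unfolding differentiable_def by metis
  have e: "frechet_derivative f (at x) v = frechet_derivative g (at x) v" if x: "x \<in> S" for x v
  proof -
    have "(f has_derivative D) (at x) \<longleftrightarrow> (g has_derivative D) (at x)" for D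
      using Suc.prems has_derivative_transform_within_open[OF _ assms(1) x] by metis
    then show ?thesis by (simp add: frechet_derivative_def)
  qed
  show ?case
    using d Suc.IH[of "\<lambda>x. frechet_derivative f (at x) v" "\<lambda>x. frechet_derivative g (at x) v" for v] e
    by simp
qed

text \<open>The induction step of all closure properties below: a candidate derivative need only be
  correct on the open set \<open>S\<close>, by \<open>Ck_on_cong\<close>.\<close>

lemma Ck_on_SucI:
  assumes "open S" "\<And>x. x \<in> S \<Longrightarrow> (f has_derivative D x) (at x)"
    and "\<And>v. Ck_on k S (\<lambda>x. D x v)"
  shows "Ck_on (Suc k) S f"
proof -
  have "Ck_on k S (\<lambda>x. frechet_derivative f (at x) v)" for v
    using Ck_on_cong[OF assms(1), of "\<lambda>x. frechet_derivative f (at x) v" "\<lambda>x. D x v"]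
      assms(3) frechet_derivative_at[OF assms(2)] by metis
  then show ?thesis using assms(2) by (auto simp: differentiable_def)
qed

lemma Ck_on_SucD:
  assumes "Ck_on (Suc k) S f"
  shows "Ck_on k S f"
  using assms
proof (induction k arbitrary: f)
  case 0
  then show ?case
    by (auto intro!: continuous_at_imp_continuous_on differentiable_imp_continuous_within)
qed auto

lemma Ck_on_subset:
  assumes "Ck_on k T f" "S \<subseteq> T"
  shows "Ck_on k S f"
  using assms(1)
proof (induction k arbitrary: f)
  case 0
  then show ?case using assms(2) by (auto intro: continuous_on_subset)
next
  case (Suc k)
  then show ?case using assms(2) by auto
qed

lemma Ck_on_has_derivative:
  assumes "Ck_on (Suc k) S f" "x \<in> S"
  shows "(f has_derivative frechet_derivative f (at x)) (at x)"
  using assms by (simp add: frechet_derivative_works)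

lemma Ck_on_const: "open S \<Longrightarrow> Ck_on k S (\<lambda>x. c)"
proof (induction k arbitrary: c)
  case (Suc k)
  show ?case by (rule Ck_on_SucI[where D = "\<lambda>x v. 0"]) (auto intro: Suc)
qed simp

lemma Ck_on_linear_comp:
  assumes "bounded_linear L" "open S" "Ck_on k S f"
  shows "Ck_on k S (\<lambda>x. L (f x))"
  using assms(3)
proof (induction k arbitrary: f)
  case 0
  then show ?case using assms(1) by (auto intro: bounded_linear.continuous_on)
next
  case (Suc k)
  show ?case
    by (rule Ck_on_SucI[OF assms(2) bounded_linear.has_derivative[OF assms(1)
          Ck_on_has_derivative[OF Suc.prems]]])
       (use Suc in auto)
qed

lemma Ck_on_linear:
  assumes "bounded_linear L" "open S"
  shows "Ck_on k S L"
proof (cases k)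
  case 0
  then show ?thesis using assms(1) by (simp add: linear_continuous_on)
next
  case (Suc j)
  show ?thesis unfolding Suc
    by (rule Ck_on_SucI[OF assms(2) bounded_linear_imp_has_derivative[OF assms(1)]])
       (simp add: Ck_on_const assms(2))
qed

lemma Ck_on_comp_linear:
  assumes "bounded_linear L" "open S" "Ck_on k T f" "L ` S \<subseteq> T"
  shows "Ck_on k S (\<lambda>x. f (L x))"
  using assms(3)
proof (induction k arbitrary: f)
  case 0
  then show ?case
    using assms(1,4) continuous_on_compose2[OF _ linear_continuous_on[OF assms(1)]] by simp
next
  case (Suc k)
  have "((\<lambda>x. f (L x)) has_derivative (\<lambda>h. frechet_derivative f (at (L x)) (L h))) (at x)"
    if "x \<in> S" for x
    by (rule has_derivative_compose[OF bounded_linear_imp_has_derivative[OF assms(1)]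
          Ck_on_has_derivative[OF Suc.prems]]) (use that assms(4) in auto)
  then show ?case by (rule Ck_on_SucI[OF assms(2)]) (use Suc in auto)
qed

lemma Ck_on_add:
  assumes "open S" "Ck_on k S f" "Ck_on k S g"
  shows "Ck_on k S (\<lambda>x. f x + g x)"
  using assms(2,3)
proof (induction k arbitrary: f g)
  case (Suc k)
  show ?case
    by (rule Ck_on_SucI[OF assms(1) has_derivative_add[OF Ck_on_has_derivative[OF Suc.prems(1)]
            Ck_on_has_derivative[OF Suc.prems(2)]]])
       (use Suc in auto)
qed (auto intro: continuous_on_add)

lemma Ck_on_mult:
  fixes f g :: "'a::real_normed_vector \<Rightarrow> real"
  assumes "open S" "Ck_on k S f" "Ck_on k S g"
  shows "Ck_on k S (\<lambda>x. f x * g x)"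
  using assms(2,3)
proof (induction k arbitrary: f g)
  case (Suc k)
  have "Ck_on k S f" "Ck_on k S g" using Suc.prems by (auto intro: Ck_on_SucD simp del: Ck_on.simps)
  then show ?case
    by (intro Ck_on_SucI[OF assms(1) has_derivative_mult[OF Ck_on_has_derivative[OF Suc.prems(1)]
            Ck_on_has_derivative[OF Suc.prems(2)]]])
       (use Suc in \<open>auto intro!: Ck_on_add assms(1)\<close>)
qed (auto intro: continuous_on_mult)

lemma Ck_on_sum:
  assumes "open S" "\<And>i. i \<in> I \<Longrightarrow> Ck_on k S (f i)"
  shows "Ck_on k S (\<lambda>x. \<Sum>i\<in>I. f i x)"
  using assms(2)
  by (induction I rule: infinite_finite_induct) (auto intro!: Ck_on_add Ck_on_const assms(1))

lemma Ck_on_prod: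
  fixes f :: "'i \<Rightarrow> 'a::real_normed_vector \<Rightarrow> real"
  assumes "open S" "\<And>i. i \<in> I \<Longrightarrow> Ck_on k S (f i)"
  shows "Ck_on k S (\<lambda>x. \<Prod>i\<in>I. f i x)"
  using assms(2)
  by (induction I rule: infinite_finite_induct) (auto intro!: Ck_on_mult Ck_on_const assms(1))

lemma Ck_on_compose_real:
  fixes g :: "real \<Rightarrow> real"
  assumes "open S" "Ck_on k T g" "Ck_on k S f" "f ` S \<subseteq> T"
  shows "Ck_on k S (\<lambda>x. g (f x))"
  using assms(2,3)
proof (induction k arbitrary: g)
  case 0
  then show ?case using assms(4) continuous_on_compose2 by auto
next
  case (Suc k)
  have eq: "frechet_derivative g (at y) u = frechet_derivative g (at y) 1 * u" if "y \<in> T" for y u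
    using bounded_linear.linear[OF has_derivative_bounded_linear[OF Ck_on_has_derivative[OF Suc.prems(1) that]]]
      linear_cmul[of "frechet_derivative g (at y)" u 1] by simp
  have der: "((\<lambda>x. g (f x)) has_derivative
      (\<lambda>h. frechet_derivative g (at (f x)) 1 * frechet_derivative f (at x) h)) (at x)"
    if "x \<in> S" for x
  proof -
    have y: "f x \<in> T" using that assms(4) by auto
    show ?thesis
      using has_derivative_compose[OF Ck_on_has_derivative[OF Suc.prems(2) that]
          Ck_on_has_derivative[OF Suc.prems(1) y]]
      by (subst (asm) eq[OF y])
  qed
  have "Ck_on k S (\<lambda>x. frechet_derivative g (at (f x)) 1)"
    by (rule Suc.IH) (use Suc.prems Ck_on_SucD[OF Suc.prems(2)] in auto)
  then show ?case
    using Suc.prems(2) by (intro Ck_on_SucI[OF assms(1) der] Ck_on_mult assms(1)) auto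
qed

lemma Ck_on_inverse: "Ck_on k (- {0}) (inverse :: real \<Rightarrow> real)"
proof (induction k)
  case 0
  then show ?case by (auto intro!: continuous_intros)
next
  case (Suc k)
  show ?case
    by (rule Ck_on_SucI[where D = "\<lambda>x h. - (inverse x * h * inverse x)"])
       (auto intro!: has_derivative_inverse' Ck_on_mult Suc Ck_on_const
          Ck_on_linear_comp[OF bounded_linear_minus[OF bounded_linear_ident]])
qed

lemma Ck_on_divide:
  fixes f g :: "'a::real_normed_vector \<Rightarrow> real"
  assumes "open S" "Ck_on k S f" "Ck_on k S g" "\<And>x. x \<in> S \<Longrightarrow> g x \<noteq> 0"
  shows "Ck_on k S (\<lambda>x. f x / g x)"
  unfolding divide_inverse
  by (rule Ck_on_mult[OF assms(1,2) Ck_on_compose_real[OF assms(1) Ck_on_inverse assms(3)]])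
     (use assms(4) in auto)

section \<open>Smooth functions vanishing on a half-line\<close>

text \<open>For \<open>p = 1\<close> this is the usual flat function \<open>exp (-1/t)\<close>. The polynomial factor makes the
  family closed under differentiation, so that smoothness is a plain induction; division by
  \<open>t\<close> also stays in the family (\<open>pCons 0 p\<close>), which settles the difference quotient at \<open>0\<close>.\<close>

definition flat :: "real poly \<Rightarrow> real \<Rightarrow> real" where
  "flat p t = (if t > 0 then poly p (1 / t) * exp (- (1 / t)) else 0)"

lemma poly_times_exp_minus_tendsto_0:
  fixes p :: "real poly"
  shows "((\<lambda>x. poly p x * exp (- x)) \<longlongrightarrow> 0) at_top"
proof -
  have "((\<lambda>x. \<Sum>i\<le>degree p. coeff p i * (x ^ i / exp x)) \<longlongrightarrow> (\<Sum>i\<le>degree p. coeff p i * 0)) at_top"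
    by (intro tendsto_intros tendsto_power_div_exp_0)
  then show ?thesis by (simp add: poly_altdef exp_minus sum_distrib_right divide_inverse mult.assoc)
qed

lemma flat_tendsto_0: "(flat p \<longlongrightarrow> 0) (at 0)"
proof -
  have "((\<lambda>t. poly p (inverse t) * exp (- inverse t)) \<longlongrightarrow> 0) (at_right 0)"
    using filterlim_compose[OF poly_times_exp_minus_tendsto_0 filterlim_inverse_at_top_right] .
  then have "(flat p \<longlongrightarrow> 0) (at_right 0)"
    by (rule Lim_transform_eventually)
       (auto simp: flat_def eventually_at_filter field_simps)
  moreover have "(flat p \<longlongrightarrow> 0) (at_left 0)"
    by (rule Lim_transform_eventually[OF tendsto_const])
       (auto simp: flat_def eventually_at_filter)
  ultimately show ?thesis by (simp add: filterlim_split_at)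
qed

lemma flat_has_derivative:
  "(flat p has_real_derivative flat ([:0, 0, 1:] * (p - pderiv p)) t) (at t)"
proof -
  consider "t > 0" | "t < 0" | "t = 0" by linarith
  then show ?thesis
  proof cases
    case 1
    have "((\<lambda>t. poly p (1 / t) * exp (- (1 / t))) has_real_derivative
        flat ([:0, 0, 1:] * (p - pderiv p)) t) (at t)"
      using 1 by (auto intro!: derivative_eq_intros DERIV_chain2[OF poly_DERIV]
          simp: flat_def field_simps power2_eq_square)
    then show ?thesis
      by (rule has_field_derivative_transform_within_open[where S = "{0<..}"])
         (use 1 in \<open>auto simp: flat_def\<close>)
  next
    case 2
    have "((\<lambda>t. 0) has_real_derivative 0) (at t)" by simp
    then have "(flat p has_real_derivative 0) (at t)"
      by (rule has_field_derivative_transform_within_open[where S = "{..<0}"])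
         (use 2 in \<open>auto simp: flat_def\<close>)
    then show ?thesis using 2 by (simp add: flat_def)
  next
    case 3
    have "(\<lambda>h. (flat p (0 + h) - flat p 0) / h) = flat (pCons 0 p)"
      by (auto simp: flat_def fun_eq_iff)
    then have "(flat p has_real_derivative 0) (at 0)"
      using flat_tendsto_0[of "pCons 0 p"] by (simp add: DERIV_def)
    then show ?thesis using 3 by (simp add: flat_def)
  qed
qed

lemma Ck_on_flat: "Ck_on k UNIV (flat p)"
proof (induction k arbitrary: p)
  case 0
  then show ?case
    unfolding Ck_on.simps
    by (intro continuous_at_imp_continuous_on ballI DERIV_isCont[OF flat_has_derivative])
next
  case (Suc k)
  show ?case
    by (rule Ck_on_SucI[OF open_UNIV
          flat_has_derivative[THEN has_field_derivative_imp_has_derivative]])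
       (auto intro!: Ck_on_mult Ck_on_const Suc)
qed

section \<open>Block matrices\<close>

lemma sum_UNIV_plus:
  "(\<Sum>k\<in>UNIV. f k) = (\<Sum>i\<in>UNIV. f (Inl i)) + (\<Sum>i\<in>UNIV. f (Inr i))"
  for f :: "'m::finite + 'n::finite \<Rightarrow> real"
  by (subst UNIV_Plus_UNIV[symmetric], subst sum.Plus) auto

lemma block_mat_mult:
  fixes A :: "real^'n^'n"
  shows "block_mat A B C D ** block_mat A' B' C' D' =
    block_mat (A ** A' + B ** C') (A ** B' + B ** D') (C ** A' + D ** C') (C ** B' + D ** D')"
  by (auto simp: block_mat_def matrix_matrix_mult_def vec_eq_iff sum_UNIV_plus split: sum.splits)

lemma block_mat_id: "block_mat (mat 1) 0 0 (mat 1) = (mat 1 :: real^('n+'n)^('n::finite+'n))"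
  by (auto simp: block_mat_def mat_def vec_eq_iff split: sum.splits)

lemma apart_block_mat: "apart (block_mat A B C D *v V) = A *v apart V + B *v bpart V"
  and bpart_block_mat: "bpart (block_mat A B C D *v V) = C *v apart V + D *v bpart V"
  for A :: "real^'n^'n"
  by (simp_all add: apart_def bpart_def block_mat_def matrix_vector_mult_def vec_eq_iff sum_UNIV_plus)

lemma state_eq_iff: "V = U \<longleftrightarrow> apart V = apart U \<and> bpart V = bpart U"
  for V :: "real^('n::finite+'n)"
  unfolding apart_def bpart_def vec_eq_iff by (auto, metis sum.exhaust)

lemma inner_state: "V \<bullet> U = apart V \<bullet> apart U + bpart V \<bullet> bpart U"
  for V :: "real^('n::finite+'n)"
  by (simp add: inner_vec_def apart_def bpart_def sum_UNIV_plus)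

lemma apart_simps [simp]: "apart 0 = 0" "apart (c *\<^sub>R V) = c *\<^sub>R apart V" "apart (state a b) = a"
  and bpart_simps [simp]: "bpart 0 = 0" "bpart (c *\<^sub>R V) = c *\<^sub>R bpart V" "bpart (state a b) = b"
  by (simp_all add: apart_def bpart_def state_def vec_eq_iff)

lemma transpose_block_mat:
  "transpose (block_mat A B C D) = block_mat (transpose A) (transpose C) (transpose B) (transpose D)"
  by (auto simp: block_mat_def transpose_def vec_eq_iff split: sum.splits)

lemma bounded_linear_apart: "bounded_linear (apart :: real^('n::finite+'n) \<Rightarrow> real^'n)"
  and bounded_linear_bpart: "bounded_linear (bpart :: real^('n::finite+'n) \<Rightarrow> real^'n)"
  unfolding linear_conv_bounded_linear[symmetric]
  by (auto intro!: linearI simp: apart_def bpart_def vec_eq_iff)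

section \<open>Positive definite matrices\<close>

lemma matrix_inv_right: "invertible A \<Longrightarrow> A ** matrix_inv A = mat 1"
  and matrix_inv_left: "invertible A \<Longrightarrow> matrix_inv A ** A = mat 1"
  for A :: "real^'n^'n"
  unfolding invertible_def matrix_inv_def by (metis (mono_tags, lifting) someI_ex)+

lemma matrix_inv_eqI: "A ** B = mat 1 \<Longrightarrow> B ** A = mat 1 \<Longrightarrow> matrix_inv A = B"
  for A B :: "real^'n^'n"
  by (metis invertible_def matrix_inv_left matrix_mul_assoc matrix_mul_lid matrix_mul_rid)

lemma sym_pos_def_invertible:
  assumes "sym_pos_def A"
  shows "invertible A"
proof -
  have "x = 0" if "A *v x = 0" for x
    using assms that unfolding sym_pos_def_def by force
  then show ?thesis
    by (simp add: invertible_left_inverse matrix_left_invertible_ker)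
qed

lemma sym_pos_def_matrix_inv:
  assumes "sym_pos_def A"
  shows "sym_pos_def (matrix_inv A)"
proof -
  note inv = sym_pos_def_invertible[OF assms]
  have tA: "transpose A = A" using assms by (simp add: sym_pos_def_def symmetric_mat_def)
  have "A ** transpose (matrix_inv A) = mat 1" "transpose (matrix_inv A) ** A = mat 1"
    using matrix_inv_left[OF inv] matrix_inv_right[OF inv]
    by (metis matrix_transpose_mul tA transpose_mat)+
  then have "transpose (matrix_inv A) = matrix_inv A"
    using matrix_inv_eqI by metis
  moreover have "x \<bullet> (matrix_inv A *v x) > 0" if "x \<noteq> 0" for x
  proof -
    let ?y = "matrix_inv A *v x"
    have x: "A *v ?y = x"
      by (simp add: matrix_vector_mul_assoc matrix_inv_right[OF inv])
    with that have "?y \<noteq> 0" by auto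
    then have "?y \<bullet> (A *v ?y) > 0" using assms by (simp add: sym_pos_def_def)
    then show ?thesis by (simp add: x inner_commute)
  qed
  ultimately show ?thesis by (simp add: sym_pos_def_def symmetric_mat_def)
qed

lemma sym_pos_def_block:
  fixes Q :: "real^'n^'n"
  assumes "sym_pos_def Q"
  shows "sym_pos_def (block_mat Q 0 0 (mat 1))"
proof -
  have "V \<bullet> (block_mat Q 0 0 (mat 1) *v V) > 0" if "V \<noteq> 0" for V
  proof (cases "apart V = 0")
    case True
    then have "bpart V \<noteq> 0" using that by (simp add: state_eq_iff)
    then show ?thesis using True by (simp add: inner_state apart_block_mat bpart_block_mat)
  next
    case False
    then have "apart V \<bullet> (Q *v apart V) > 0" using assms by (simp add: sym_pos_def_def)
    then show ?thesis
      by (simp add: inner_state apart_block_mat bpart_block_mat add_pos_nonneg)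
  qed
  moreover have "transpose (0 :: real^'n^'n) = 0" by (simp add: transpose_def vec_eq_iff)
  ultimately show ?thesis
    using assms by (simp add: sym_pos_def_def symmetric_mat_def transpose_block_mat transpose_mat)
qed

lemma matrix_inv_block:
  fixes A :: "real^'n^'n"
  assumes "invertible A"
  shows "invertible (block_mat A 0 0 (mat 1))"
    and "matrix_inv (block_mat A 0 0 (mat 1)) = block_mat (matrix_inv A) 0 0 (mat 1)"
proof -
  have "block_mat A 0 0 (mat 1) ** block_mat (matrix_inv A) 0 0 (mat 1) = mat 1"
    "block_mat (matrix_inv A) 0 0 (mat 1) ** block_mat A 0 0 (mat 1) = mat 1"
    by (simp_all add: block_mat_mult matrix_inv_left[OF assms] matrix_inv_right[OF assms] block_mat_id)
  then show "invertible (block_mat A 0 0 (mat 1))"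
    "matrix_inv (block_mat A 0 0 (mat 1)) = block_mat (matrix_inv A) 0 0 (mat 1)"
    by (auto simp: invertible_def intro: matrix_inv_eqI)
qed

lemma quadratic_form_coercive:
  fixes A :: "real^'n^'n"
  assumes "\<And>x. x \<noteq> 0 \<Longrightarrow> x \<bullet> (A *v x) > 0"
  obtains \<theta> where "\<theta> > 0" "\<And>x. x \<bullet> (A *v x) \<ge> \<theta> * (norm x)\<^sup>2"
proof -
  let ?S = "sphere (0::real^'n) 1"
  have ne: "?S \<noteq> {}" by simp
  have "continuous_on ?S (\<lambda>x. x \<bullet> (A *v x))"
    by (intro continuous_intros linear_continuous_on) auto
  then obtain u where u: "u \<in> ?S" "\<And>x. x \<in> ?S \<Longrightarrow> u \<bullet> (A *v u) \<le> x \<bullet> (A *v x)"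
    using continuous_attains_inf[OF compact_sphere ne] by blast
  show ?thesis
  proof
    show "u \<bullet> (A *v u) > 0" using u(1) by (intro assms) auto
    fix x :: "real^'n"
    show "x \<bullet> (A *v x) \<ge> u \<bullet> (A *v u) * (norm x)\<^sup>2"
    proof (cases "x = 0")
      case False
      define y where "y = (1 / norm x) *\<^sub>R x"
      have x: "x = norm x *\<^sub>R y" using False by (simp add: y_def)
      have "u \<bullet> (A *v u) \<le> y \<bullet> (A *v y)" using False by (intro u(2)) (simp add: y_def)
      then have "u \<bullet> (A *v u) * (norm x)\<^sup>2 \<le> (y \<bullet> (A *v y)) * (norm x)\<^sup>2"
        by (intro mult_right_mono) auto
      also have "\<dots> = x \<bullet> (A *v x)"
      proof -
        have "(norm x *\<^sub>R y) \<bullet> (A *v (norm x *\<^sub>R y)) = (y \<bullet> (A *v y)) * (norm x)\<^sup>2"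
          by (simp add: matrix_vector_mult_scaleR power2_eq_square)
        then show ?thesis by (simp flip: x)
      qed
      finally show ?thesis .
    qed simp
  qed
qed

text \<open>The positive minimum \<open>\<theta>\<close> of the quadratic form on the unit sphere leaves room for any
  perturbation of the entries whose absolute values sum to less than \<open>\<theta>\<close>.\<close>

lemma eventually_pos_def:
  fixes M :: "real^'n \<Rightarrow> real^'n^'n"
  assumes "isCont M a" "sym_pos_def (M a)"
  shows "\<forall>\<^sub>F x in nhds a. \<forall>v. v \<noteq> 0 \<longrightarrow> v \<bullet> (M x *v v) > 0"
proof -
  obtain \<theta> where th: "\<theta> > 0" "\<And>v. v \<bullet> (M a *v v) \<ge> \<theta> * (norm v)\<^sup>2"
    using quadratic_form_coercive assms(2) unfolding sym_pos_def_def by metis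
  let ?d = "\<lambda>x. \<Sum>i\<in>UNIV. \<Sum>j\<in>UNIV. \<bar>(M x - M a) $ i $ j\<bar>"
  have "(M \<longlongrightarrow> M a) (nhds a)" using assms(1) by (simp add: isCont_def tendsto_at_iff_tendsto_nhds)
  then have "(?d \<longlongrightarrow> (\<Sum>i\<in>UNIV. \<Sum>j\<in>UNIV. \<bar>(M a - M a) $ i $ j\<bar>)) (nhds a)"
    by (intro tendsto_intros)
  then have "\<forall>\<^sub>F x in nhds a. ?d x < \<theta>" using th(1) by (intro order_tendstoD(2)) auto
  then show ?thesis
  proof eventually_elim
    case (elim x)
    show ?case
    proof (intro allI impI)
      fix v :: "real^'n" assume v: "v \<noteq> 0"
      have "norm ((M x - M a) *v v) \<le> onorm ((*v) (M x - M a)) * norm v"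
        by (rule onorm) simp
      also have "\<dots> \<le> ?d x * norm v"
        by (intro mult_right_mono onorm_le_matrix_component_sum) simp
      finally have "norm ((M x - M a) *v v) \<le> ?d x * norm v" .
      then have "norm v * norm ((M x - M a) *v v) \<le> norm v * (?d x * norm v)"
        by (intro mult_left_mono) auto
      moreover have "?d x * (norm v)\<^sup>2 < \<theta> * (norm v)\<^sup>2"
        using elim v by (intro mult_strict_right_mono) auto
      moreover have "\<bar>v \<bullet> ((M x - M a) *v v)\<bar> \<le> norm v * norm ((M x - M a) *v v)"
        by (rule Cauchy_Schwarz_ineq2)
      ultimately have "\<bar>v \<bullet> ((M x - M a) *v v)\<bar> < \<theta> * (norm v)\<^sup>2"
        by (simp add: power2_eq_square mult_ac)
      moreover have "v \<bullet> (M x *v v) = v \<bullet> (M a *v v) + v \<bullet> ((M x - M a) *v v)"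
        by (simp add: matrix_vector_mult_diff_rdistrib inner_diff_right)
      ultimately show "v \<bullet> (M x *v v) > 0" using th(2)[of v] by linarith
    qed
  qed
qed

section \<open>Strict hyperbolicity and convexity of the potential\<close>

lemma symmetric_mat_eigenvectors_orthogonal:
  assumes "symmetric_mat M" "is_eigenvector M k v" "is_eigenvector M l w" "k \<noteq> l"
  shows "v \<bullet> w = 0"
proof -
  have "(M *v v) \<bullet> w = v \<bullet> (M *v w)"
    using assms(1) by (metis dot_lmul_matrix symmetric_mat_def vector_transpose_matrix transpose_transpose)
  then have "(k - l) * (v \<bullet> w) = 0"
    using assms(2,3) by (simp add: is_eigenvector_def left_diff_distrib)
  with assms(4) show ?thesis by simp
qed

lemma symmetric_mat_eigenbasis:
  fixes M :: "real^'n^'n"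
  assumes "symmetric_mat M" "L \<subseteq> real_eigenvalues M"
  obtains v where "\<And>l. l \<in> L \<Longrightarrow> is_eigenvector M l (v l)" "inj_on v L" "independent (v ` L)"
    "finite L" "card L \<le> CARD('n)"
proof -
  obtain v where v: "\<And>l. l \<in> L \<Longrightarrow> is_eigenvector M l (v l)"
    using assms(2) unfolding real_eigenvalues_def subset_eq by simp metis
  have orth: "v k \<bullet> v l = 0" if "k \<in> L" "l \<in> L" "k \<noteq> l" for k l
    using symmetric_mat_eigenvectors_orthogonal[OF assms(1) v v] that by blast
  have nz: "v l \<noteq> 0" if "l \<in> L" for l using v[OF that] by (simp add: is_eigenvector_def)
  have inj: "inj_on v L"
    by (rule inj_onI) (metis orth nz inner_eq_zero_iff)
  have ind: "independent (v ` L)"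
    by (rule pairwise_orthogonal_independent)
       (use orth nz in \<open>auto simp: pairwise_def orthogonal_def\<close>)
  have "finite (v ` L)" "card (v ` L) \<le> CARD('n)"
    using independent_bound[OF ind] by auto
  then show ?thesis
    using that[OF v inj ind] inj by (auto simp: finite_image_iff card_image)
qed

text \<open>Eigenvectors to \<open>n\<close> different eigenvalues of a symmetric matrix are an orthogonal basis, in
  which the quadratic form is a combination of squares with positive coefficients.\<close>

lemma sym_pos_def_if_positive_eigenvalues:
  fixes M :: "real^'n^'n"
  assumes sym: "symmetric_mat M" and card: "CARD('n) \<le> card {l \<in> real_eigenvalues M. l > 0}"
  shows "sym_pos_def M"
proof -
  let ?L = "{l \<in> real_eigenvalues M. l > 0}"
  obtain v where v: "\<And>l. l \<in> ?L \<Longrightarrow> is_eigenvector M l (v l)" "inj_on v ?L" "independent (v ` ?L)"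
    and fin: "finite ?L"
    using symmetric_mat_eigenbasis[OF sym, of ?L] by blast
  have "UNIV \<subseteq> span (v ` ?L)"
    using card by (intro card_ge_dim_independent v(3)) (auto simp: card_image[OF v(2)])
  then have span: "x \<in> span (v ` ?L)" for x by blast
  have "x \<bullet> (M *v x) > 0" if x: "x \<noteq> 0" for x
  proof -
    obtain u where "x = (\<Sum>b\<in>v ` ?L. u b *\<^sub>R b)"
      using span[of x] fin by (auto simp: span_finite)
    then obtain c where c: "x = (\<Sum>l\<in>?L. c l *\<^sub>R v l)"
      using that[of "u \<circ> v"] by (simp add: sum.reindex[OF v(2)])
    have Mx: "M *v x = (\<Sum>l\<in>?L. (c l * l) *\<^sub>R v l)"
      unfolding c using v(1)
      by (subst linear_sum[OF matrix_vector_mul_linear])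
         (auto intro!: sum.cong simp: matrix_vector_mult_scaleR is_eigenvector_def)
    have vMx: "v l \<bullet> (M *v x) = c l * l * (v l \<bullet> v l)" if "l \<in> ?L" for l
    proof -
      have "v l \<bullet> (M *v x) = (\<Sum>k\<in>?L. c k * k * (v l \<bullet> v k))"
        by (simp add: Mx inner_sum_right)
      also have "\<dots> = (\<Sum>k\<in>?L. if k = l then c l * l * (v l \<bullet> v l) else 0)"
        using symmetric_mat_eigenvectors_orthogonal[OF sym v(1) v(1)] that
        by (intro sum.cong) auto
      finally show ?thesis using that fin by simp
    qed
    have "x \<bullet> (M *v x) = (\<Sum>l\<in>?L. c l * (v l \<bullet> (M *v x)))"
      by (subst (1) c) (simp add: inner_sum_left)
    also have "\<dots> = (\<Sum>l\<in>?L. l * (c l)\<^sup>2 * (v l \<bullet> v l))"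
      by (intro sum.cong) (auto simp: vMx power2_eq_square)
    also have "\<dots> > 0"
    proof -
      obtain l where "l \<in> ?L" "c l \<noteq> 0"
        using x c by (metis (no_types, lifting) scaleR_zero_left sum.neutral)
      moreover from this have "v l \<noteq> 0" using v(1) by (simp add: is_eigenvector_def)
      ultimately show ?thesis
        using fin by (intro sum_pos2[of _ l]) auto
    qed
    finally show ?thesis .
  qed
  then show ?thesis using sym by (simp add: sym_pos_def_def)
qed

text \<open>Eliminating \<open>b\<close> from \<open>-b = l a\<close>, \<open>-M a = l b\<close> turns the first-order eigenvalue problem for
  \<open>DG\<close> into the one for \<open>M\<close> with squared wave speed.\<close>

lemma eigenvector_first_order_block:
  fixes M :: "real^'n^'n"
  assumes "is_eigenvector (block_mat 0 (- mat 1) (- M) 0) l V"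
  shows "is_eigenvector M (l\<^sup>2) (apart V)" "bpart V = - (l *\<^sub>R apart V)"
proof -
  have neg: "(- A) *v x = - (A *v x)" for A :: "real^'n^'n" and x
    by (simp add: matrix_vector_mult_def vec_eq_iff sum_negf)
  have V: "V \<noteq> 0" "block_mat 0 (- mat 1) (- M) 0 *v V = l *\<^sub>R V"
    using assms by (auto simp: is_eigenvector_def)
  have a: "- bpart V = l *\<^sub>R apart V" and b: "- (M *v apart V) = l *\<^sub>R bpart V"
    using arg_cong[OF V(2), of apart] arg_cong[OF V(2), of bpart]
    by (simp_all add: apart_block_mat bpart_block_mat neg)
  show eq: "bpart V = - (l *\<^sub>R apart V)" using a by (metis minus_minus)
  have "M *v apart V = - (l *\<^sub>R bpart V)" using b by (metis minus_minus)
  also have "\<dots> = l\<^sup>2 *\<^sub>R apart V" by (simp add: eq power2_eq_square)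
  finally show "is_eigenvector M (l\<^sup>2) (apart V)"
    using V(1) eq by (auto simp: is_eigenvector_def state_eq_iff)
qed

text \<open>An eigenvalue \<open>\<mu>\<close> of \<open>M\<close> comes from at most the two speeds \<open>sqrt \<mu>\<close> and \<open>- sqrt \<mu>\<close>, and the
  second adds a new one only if \<open>\<mu> > 0\<close>. As \<open>M\<close> has at most \<open>n\<close> eigenvalues, \<open>2n\<close> speeds
  require \<open>n\<close> positive ones.\<close>

lemma strictly_hyperbolic_imp_pos_def:
  fixes M :: "real^'n^'n"
  assumes sym: "symmetric_mat M"
    and card: "card (real_eigenvalues (block_mat 0 (- mat 1) (- M) 0)) = 2 * CARD('n)"
  shows "sym_pos_def M"
proof (rule sym_pos_def_if_positive_eigenvalues[OF sym])
  let ?X = "real_eigenvalues (block_mat 0 (- mat 1) (- M) 0)"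
  let ?Y = "real_eigenvalues M" and ?P = "{l \<in> real_eigenvalues M. l > 0}"
  have Y: "finite ?Y" "card ?Y \<le> CARD('n)"
    using symmetric_mat_eigenbasis[OF sym subset_refl] by blast+
  have "?X \<subseteq> sqrt ` ?Y \<union> (\<lambda>y. - sqrt y) ` ?P"
  proof
    fix l assume "l \<in> ?X"
    then have l: "l\<^sup>2 \<in> ?Y"
      using eigenvector_first_order_block(1) by (auto simp: real_eigenvalues_def)
    show "l \<in> sqrt ` ?Y \<union> (\<lambda>y. - sqrt y) ` ?P"
    proof (cases "l \<ge> 0")
      case True
      then have "l = sqrt (l\<^sup>2)" by simp
      then show ?thesis using l by blast
    next
      case False
      then have "l = - sqrt (l\<^sup>2)" "l\<^sup>2 > 0" by auto
      then show ?thesis using l by blast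
    qed
  qed
  then have "card ?X \<le> card (sqrt ` ?Y \<union> (\<lambda>y. - sqrt y) ` ?P)"
    using Y(1) by (intro card_mono) auto
  also have "\<dots> \<le> card (sqrt ` ?Y) + card ((\<lambda>y. - sqrt y) ` ?P)" by (rule card_Un_le)
  also have "\<dots> \<le> card ?Y + card ?P"
    using Y(1) by (intro add_mono card_image_le) auto
  finally show "CARD('n) \<le> card ?P" using card Y(2) by simp
qed

section \<open>Smoothness of the inverse matrix\<close>

lemma Ck_on_component:
  fixes f :: "'a::real_normed_vector \<Rightarrow> 'b::real_normed_vector^'n"
  assumes "open S" "Ck_on k S f"
  shows "Ck_on k S (\<lambda>x. f x $ i)"
  by (rule Ck_on_linear_comp[OF bounded_linear_vec_nth assms])

lemma Ck_on_matrixI: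
  fixes F :: "'a::real_normed_vector \<Rightarrow> real^'m^'n"
  assumes "open S" "\<And>i j. Ck_on k S (\<lambda>x. F x $ i $ j)"
  shows "Ck_on k S F"
proof -
  have eq: "F x = (\<Sum>i\<in>UNIV. \<Sum>j\<in>UNIV. F x $ i $ j *\<^sub>R axis i (axis j 1))" for x
    by (simp add: vec_eq_iff axis_def if_distrib[of "\<lambda>v. v $ _"] if_distrib[of "\<lambda>v. _ * v"]
        sum.If_cases cong: if_cong)
  have "Ck_on k S (\<lambda>x. \<Sum>i\<in>UNIV. \<Sum>j\<in>UNIV. F x $ i $ j *\<^sub>R axis i (axis j 1) :: real^'m^'n)"
    by (intro Ck_on_sum assms Ck_on_linear_comp[OF bounded_linear_scaleR_left])
  then show ?thesis by (rule Ck_on_cong[OF assms(1) eq, THEN iffD2])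
qed

lemma Ck_on_det:
  fixes A :: "'a::real_normed_vector \<Rightarrow> real^'n^'n"
  assumes "open S" "\<And>i j. Ck_on k S (\<lambda>x. A x $ i $ j)"
  shows "Ck_on k S (\<lambda>x. det (A x))"
  unfolding det_def by (intro Ck_on_sum Ck_on_mult Ck_on_prod Ck_on_const assms)

lemma matrix_inv_cramer:
  fixes A :: "real^'n^'n"
  assumes "invertible A"
  shows "matrix_inv A $ i $ j =
    det (\<chi> k l. if l = i then (if k = j then 1 else 0) else A $ k $ l) / det A"
proof -
  have "A *v column j (matrix_inv A) = column j (A ** matrix_inv A)"
    by (simp add: matrix_vector_mult_def matrix_matrix_mult_def column_def vec_eq_iff)
  also have "\<dots> = (\<chi> k. if k = j then 1 else 0)"
    by (simp add: matrix_inv_right[OF assms] column_def mat_def vec_eq_iff)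
  finally have "A *v column j (matrix_inv A) = (\<chi> k. if k = j then 1 else 0)" .
  then have "column j (matrix_inv A) $ i =
      det (\<chi> k l. if l = i then (\<chi> k. if k = j then 1 else 0) $ k else A $ k $ l) / det A"
    using assms by (simp add: invertible_det_nz cramer)
  then show ?thesis by (simp add: column_def cong: if_cong)
qed

lemma Ck_on_matrix_inv:
  fixes A :: "'a::real_normed_vector \<Rightarrow> real^'n^'n"
  assumes "open S" "Ck_on k S A" "\<And>x. x \<in> S \<Longrightarrow> invertible (A x)"
  shows "Ck_on k S (\<lambda>x. matrix_inv (A x))"
proof (rule Ck_on_matrixI[OF assms(1)])
  fix i j
  let ?D = "\<lambda>x. det (\<chi> k l. if l = i then (if k = j then 1 else 0) else A x $ k $ l)"
  have entry: "Ck_on k S (\<lambda>x. A x $ m $ l)" for m l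
    by (intro Ck_on_component assms)
  have smooth: "Ck_on k S (\<lambda>x. ?D x / det (A x))"
  proof (intro Ck_on_divide Ck_on_det assms(1) entry)
    show "Ck_on k S (\<lambda>x. (\<chi> k l. if l = i then (if k = j then 1 else 0) else A x $ k $ l) $ m $ l)"
      for m l
      using entry[of m l] by (cases "l = i") (auto simp: Ck_on_const assms(1))
    show "det (A x) \<noteq> 0" if "x \<in> S" for x
      using assms(3)[OF that] by (simp add: invertible_det_nz)
  qed
  have eq: "matrix_inv (A x) $ i $ j = ?D x / det (A x)" if "x \<in> S" for x
    by (rule matrix_inv_cramer[OF assms(3)[OF that]])
  from smooth show "Ck_on k S (\<lambda>x. matrix_inv (A x) $ i $ j)"
    by (rule iffD2[OF Ck_on_cong[OF assms(1) eq], rotated])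
qed

section \<open>A positive definite modification of the Hessian\<close>

lemma mat_mult_vector: "(mat c :: real^'n^'n) *v x = c *\<^sub>R x"
  by (simp add: matrix_vector_mult_def mat_def vec_eq_iff if_distrib[of "\<lambda>u. u * _"] cong: if_cong)

text \<open>The function \<open>h\<close> is a product of two factors, one for each point, that are flat near it and
  bounded below away from it. In between, where \<open>h\<close> may be small, both \<open>M\<close> is positive
  definite and \<open>h\<close> is nonnegative.\<close>

lemma exists_pos_def_regularization:
  fixes M :: "real^'n \<Rightarrow> real^'n^'n"
  assumes sym: "\<And>a. symmetric_mat (M a)"
    and lower: "\<And>a v. v \<bullet> (M a *v v) \<ge> - (norm v)\<^sup>2"
    and cont: "\<And>a. isCont M a"
    and pd: "sym_pos_def (M a1)" "sym_pos_def (M a2)"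
  obtains h :: "real^'n \<Rightarrow> real" where "\<And>k. Ck_on k UNIV h"
    "\<And>a. sym_pos_def (M a + mat (h a))"
    "\<forall>\<^sub>F a in nhds a1. h a = 0 \<and> sym_pos_def (M a)" "\<forall>\<^sub>F a in nhds a2. h a = 0 \<and> sym_pos_def (M a)"
proof -
  obtain r1 where r1: "r1 > 0" "\<And>a v. dist a a1 < r1 \<Longrightarrow> v \<noteq> 0 \<Longrightarrow> v \<bullet> (M a *v v) > 0"
    using eventually_pos_def[OF cont pd(1)] unfolding eventually_nhds_metric by blast
  obtain r2 where r2: "r2 > 0" "\<And>a v. dist a a2 < r2 \<Longrightarrow> v \<noteq> 0 \<Longrightarrow> v \<bullet> (M a *v v) > 0"
    using eventually_pos_def[OF cont pd(2)] unfolding eventually_nhds_metric by blast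
  \<comment> \<open>\<open>2d\<close> is the smaller squared radius: the factors vanish where the squared distance is at most
    \<open>d\<close>, and are at least \<open>exp (-1/d)\<close> where it is at least \<open>2d\<close>.\<close>
  define d where "d = (min r1 r2)\<^sup>2 / 2"
  have d: "d > 0" using r1 r2 by (simp add: d_def)
  define f where "f c a = flat 1 ((norm (a - c))\<^sup>2 - d)" for c a :: "real^'n"
  \<comment> \<open>The constant makes \<open>h \<ge> 2\<close> far from both points, which beats \<open>M \<ge> -Id\<close>.\<close>
  define h where "h a = 2 * (exp (1 / d))\<^sup>2 * (f a1 a * f a2 a)" for a
  have f_nonneg: "f c a \<ge> 0" for c a by (simp add: f_def flat_def)
  have f_near: "f c a = 0" if "dist a c < sqrt d" for c a
  proof -
    have "(dist a c)\<^sup>2 < (sqrt d)\<^sup>2" using that by (intro power_strict_mono) auto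
    then show ?thesis using d by (simp add: f_def flat_def dist_norm)
  qed
  have f_far: "f c a \<ge> exp (- (1 / d))" if "dist a c \<ge> min r1 r2" for c a
  proof -
    have "(min r1 r2)\<^sup>2 \<le> (dist a c)\<^sup>2" using that r1 r2 by (intro power_mono) auto
    then have "d \<le> (norm (a - c))\<^sup>2 - d" by (simp add: d_def dist_norm)
    then show ?thesis using d by (auto simp: f_def flat_def intro!: divide_left_mono)
  qed
  have f_smooth: "Ck_on k UNIV (f c)" for k c
  proof -
    have "Ck_on k UNIV (\<lambda>a. (\<Sum>i\<in>UNIV. (a $ i + - (c $ i)) * (a $ i + - (c $ i))) + - d)"
      by (intro Ck_on_add Ck_on_sum Ck_on_mult Ck_on_const Ck_on_linear bounded_linear_vec_nth open_UNIV)
    from Ck_on_compose_real[OF open_UNIV Ck_on_flat this, of 1] show ?thesis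
      by (simp add: f_def[abs_def] power2_norm_eq_inner inner_vec_def)
  qed
  have near: "h a = 0 \<and> sym_pos_def (M a)" if "dist a a1 < min (sqrt d) r1 \<or> dist a a2 < min (sqrt d) r2" for a
    using that f_near[of a] r1(2) r2(2) sym[of a] by (auto simp: h_def sym_pos_def_def)
  show ?thesis
  proof
    show "Ck_on k UNIV h" for k
      unfolding h_def[abs_def] by (intro Ck_on_mult Ck_on_const f_smooth open_UNIV)
    show "sym_pos_def (M a + mat (h a))" for a
    proof -
      have split: "v \<bullet> ((M a + mat (h a)) *v v) = v \<bullet> (M a *v v) + h a * (norm v)\<^sup>2" for v
        by (simp add: matrix_vector_mult_add_rdistrib inner_add_right mat_mult_vector power2_norm_eq_inner)
      have h_nonneg: "h a \<ge> 0" by (simp add: h_def f_nonneg)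
      have "v \<bullet> (M a *v v) + h a * (norm v)\<^sup>2 > 0" if v: "v \<noteq> 0" for v
      proof (cases "dist a a1 < r1 \<or> dist a a2 < r2")
        case True
        then have "v \<bullet> (M a *v v) > 0" using r1(2) r2(2) v by blast
        then show ?thesis using h_nonneg by (simp add: add_pos_nonneg)
      next
        case False
        then have "exp (- (1 / d)) * exp (- (1 / d)) \<le> f a1 a * f a2 a"
          by (intro mult_mono f_far f_nonneg) auto
        then have "2 * (exp (1 / d))\<^sup>2 * (exp (- (1 / d)) * exp (- (1 / d))) \<le> h a"
          unfolding h_def by (intro mult_left_mono) auto
        then have "2 \<le> h a" by (simp add: power2_eq_square exp_minus field_simps)
        then have "2 * (norm v)\<^sup>2 \<le> h a * (norm v)\<^sup>2" by (intro mult_right_mono) auto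
        moreover have "(norm v)\<^sup>2 > 0" using v by simp
        ultimately show ?thesis using lower[of v a] by linarith
      qed
      moreover have "symmetric_mat (M a + mat (h a))"
        using sym[of a] by (simp add: symmetric_mat_def transpose_def mat_def vec_eq_iff)
      ultimately show ?thesis by (simp add: sym_pos_def_def split)
    qed
    show "\<forall>\<^sub>F a in nhds a1. h a = 0 \<and> sym_pos_def (M a)"
      unfolding eventually_nhds_metric using near d r1 by (intro exI[of _ "min (sqrt d) r1"]) auto
    show "\<forall>\<^sub>F a in nhds a2. h a = 0 \<and> sym_pos_def (M a)"
      unfolding eventually_nhds_metric using near d r2 by (intro exI[of _ "min (sqrt d) r2"]) auto
  qed
qed

section \<open>Gradients and Hessians\<close>

lemma gradient_eqI:
  assumes "(f has_derivative (\<lambda>h. G \<bullet> h)) (at x)"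
  shows "gradient f x = G"
  unfolding gradient_def frechet_derivative_at[OF assms, symmetric] by (simp add: inner_axis)

lemma hessian_eqI:
  assumes "\<And>y. gradient f y = g y" "(g has_derivative (\<lambda>h. H *v h)) (at x)"
  shows "hessian f x = H"
proof -
  have "gradient f = g" using assms(1) by blast
  then show ?thesis
    by (simp add: hessian_def jacobian_def frechet_derivative_at[OF assms(2), symmetric])
qed

lemma hessian_entropy:
  fixes S :: "'n::finite planar_system"
  assumes g: "\<And>a. (pot S has_derivative (\<lambda>h. g a \<bullet> h)) (at a)"
    and M: "\<And>a. (g has_derivative (\<lambda>h. M a *v h)) (at a)"
  shows "hessian (entropy S) V = block_mat (M (apart V)) 0 0 (mat 1)"
proof (rule hessian_eqI)
  note da = bounded_linear_imp_has_derivative[OF bounded_linear_apart]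
  note db = bounded_linear_imp_has_derivative[OF bounded_linear_bpart]
  show "gradient (entropy S) U = state (g (apart U)) (bpart U)" for U
  proof (rule gradient_eqI)
    have "((\<lambda>U. (1/2) * (bpart U \<bullet> bpart U) + pot S (apart U)) has_derivative
      (\<lambda>h. (1/2) * (bpart U \<bullet> bpart h + bpart h \<bullet> bpart U) + g (apart U) \<bullet> apart h)) (at U)"
      by (intro has_derivative_add has_derivative_mult_right has_derivative_inner db
          has_derivative_compose[OF da g])
    then show "(entropy S has_derivative (\<lambda>h. state (g (apart U)) (bpart U) \<bullet> h)) (at U)"
      by (simp add: entropy_def[abs_def] power2_norm_eq_inner inner_state inner_commute add.commute)
  qed
  have lin: "bounded_linear (\<lambda>p. state (fst p) (snd p) :: real^('n+'n))"
    unfolding linear_conv_bounded_linear[symmetric]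
    by (auto intro!: linearI simp: state_def vec_eq_iff split: sum.splits)
  have "((\<lambda>U. state (g (apart U)) (bpart U)) has_derivative
      (\<lambda>h. state (M (apart V) *v apart h) (bpart h))) (at V)"
    using has_derivative_compose[OF has_derivative_Pair[OF has_derivative_compose[OF da M] db]
        bounded_linear_imp_has_derivative[OF lin]] by simp
  moreover have "state (M (apart V) *v apart h) (bpart h) = block_mat (M (apart V)) 0 0 (mat 1) *v h" for h
    by (simp add: state_eq_iff apart_block_mat bpart_block_mat)
  ultimately show "((\<lambda>U. state (g (apart U)) (bpart U)) has_derivative
      (\<lambda>h. block_mat (M (apart V)) 0 0 (mat 1) *v h)) (at V)" by simp
qed

section \<open>Elastic systems whose potential has Hessian bounded below\<close>

text \<open>The endstates are only limits of the profile and need not lie in \<open>R\<close>; the elliptic lower bound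
  survives because its constant does not depend on the point.\<close>

lemma elliptic_at_limit:
  fixes f :: "'t \<Rightarrow> real^'n"
  assumes ell: "uniformly_elliptic_on R B" and R: "\<And>z. f z \<in> R"
    and lim: "(f \<longlongrightarrow> a) F" "F \<noteq> bot" and cont: "isCont B a" and x: "x \<noteq> 0"
  shows "x \<bullet> (B a *v x) > 0"
proof -
  obtain \<theta> where th: "\<theta> > 0" "\<And>a x. a \<in> R \<Longrightarrow> x \<bullet> (B a *v x) \<ge> \<theta> * (norm x)\<^sup>2"
    using ell unfolding uniformly_elliptic_on_def by blast
  have "((\<lambda>z. B (f z)) \<longlongrightarrow> B a) F" using isCont_tendsto_compose[OF cont lim(1)] .
  then have "((\<lambda>z. x \<bullet> (B (f z) *v x)) \<longlongrightarrow> x \<bullet> (B a *v x)) F"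
    unfolding matrix_vector_mult_def inner_vec_def by (simp, intro tendsto_intros)
  then have "\<theta> * (norm x)\<^sup>2 \<le> x \<bullet> (B a *v x)"
    using th(2) R by (intro tendsto_lowerbound[OF _ _ lim(2)]) auto
  moreover have "\<theta> * (norm x)\<^sup>2 > 0" using th(1) x by simp
  ultimately show ?thesis by linarith
qed

lemma sym_part_quadratic_form: "x \<bullet> (sym_part A *v x) = x \<bullet> (A *v x)"
proof -
  have "x \<bullet> (transpose A *v x) = x \<bullet> (A *v x)"
    by (metis dot_lmul_matrix inner_commute vector_transpose_matrix transpose_transpose)
  then show ?thesis
    by (simp add: sym_part_def scaleR_matrix_vector_assoc[symmetric] matrix_vector_mult_add_rdistrib
        inner_add_right)
qed

text \<open>The construction of the symmetrizer. The bound \<open>M \<ge> -Id\<close> is what allows a scalar multiple of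
  the identity of bounded size to restore positivity.\<close>

lemma symmetrizable_if_pot_hessian_bounded_below:
  fixes S :: "'n::finite planar_system"
  assumes g: "\<And>a. (pot S has_derivative (\<lambda>h. g a \<bullet> h)) (at a)"
    and M: "\<And>a. (g has_derivative (\<lambda>h. M a *v h)) (at a)"
    and sym: "\<And>a. symmetric_mat (M a)"
    and lower: "\<And>a v. v \<bullet> (M a *v v) \<ge> - (norm v)\<^sup>2"
    and smooth: "\<And>k. Ck_on k UNIV M"
    and adm: "open (adm S)" and visc: "continuous_on (adm S) (visc S)"
    and profile: "admissible_profile S s Vbar Vm Vp R"
  shows "symmetrizable_hyperbolic_parabolic S R Vm Vp"
proof -
  have grad: "gradient (pot S) = g" using gradient_eqI[OF g] by blast
  have hess: "hessian (pot S) a = M a" for a using hessian_eqI[OF gradient_eqI[OF g] M] .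
  have Dflux: "Dflux S V = block_mat 0 (- mat 1) (- M (apart V)) 0" for V
    using Dflux_block[of S V] M by (auto simp: grad hess differentiable_def)
  have vis: "uniformly_elliptic_on R (visc S)" "\<And>z. apart (Vbar z) \<in> R"
    "(Vbar \<longlongrightarrow> Vm) at_bot" "(Vbar \<longlongrightarrow> Vp) at_top"
    and hyp: "Vm \<in> strict_hyperbolicity_region S" "Vp \<in> strict_hyperbolicity_region S"
    using profile by (auto simp: admissible_profile_def viscous_shock_profile_def)
  have pd: "sym_pos_def (M (apart V))" if "V \<in> {Vm, Vp}" for V
    by (rule strictly_hyperbolic_imp_pos_def[OF sym])
       (use that hyp Dflux in \<open>auto simp: strict_hyperbolicity_region_def\<close>)
  have cont: "isCont M a" for a
    using smooth[of 0] by (simp add: continuous_on_eq_continuous_at)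
  obtain h where h: "\<And>k. Ck_on k UNIV h" "\<And>a. sym_pos_def (M a + mat (h a))"
    and h0: "\<forall>\<^sub>F a in nhds (apart Vm). h a = 0 \<and> sym_pos_def (M a)"
      "\<forall>\<^sub>F a in nhds (apart Vp). h a = 0 \<and> sym_pos_def (M a)"
    using exists_pos_def_regularization[OF sym lower cont pd pd] by blast
  define N where "N a = M a + mat (h a)" for a
  define Q where "Q V = matrix_inv (N (apart V))" for V :: "real^('n+'n)"
  define A0 where "A0 V = block_mat (Q V) 0 0 (mat 1)" for V
  have Q_pd: "sym_pos_def (Q V)" for V
    using h(2) by (simp add: Q_def N_def sym_pos_def_matrix_inv)
  have op: "open (state_space S)"
  proof -
    have "state_space S = apart -` adm S" by (auto simp: state_space_def)
    then show ?thesis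
      using open_vimage[OF adm linear_continuous_on[OF bounded_linear_apart]] by simp
  qed
  have Q_smooth: "Ck_on k UNIV Q" for k
  proof -
    have "Ck_on k UNIV (\<lambda>a. mat (h a) :: real^'n^'n)"
    proof (intro Ck_on_matrixI open_UNIV)
      show "Ck_on k UNIV (\<lambda>a. (mat (h a) :: real^'n^'n) $ i $ j)" for i j
        using h(1)[of k] by (cases "i = j") (simp_all add: mat_def Ck_on_const)
    qed
    then have "Ck_on k UNIV N"
      unfolding N_def[abs_def] by (intro Ck_on_add open_UNIV smooth)
    then have "Ck_on k UNIV (\<lambda>a. matrix_inv (N a))"
      using h(2) Ck_on_matrix_inv[OF open_UNIV] sym_pos_def_invertible unfolding N_def by blast
    then show ?thesis
      unfolding Q_def[abs_def] by (intro Ck_on_comp_linear[OF bounded_linear_apart]) auto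
  qed
  have "Ck_on k UNIV A0" for k
  proof (intro Ck_on_matrixI open_UNIV)
    show "Ck_on k UNIV (\<lambda>V. A0 V $ i $ j)" for i j
      using Ck_on_component[OF open_UNIV Ck_on_component[OF open_UNIV Q_smooth]]
      by (cases i; cases j) (simp_all add: A0_def block_mat_def Ck_on_const)
  qed
  then have A0_smooth: "smooth_on (state_space S) A0"
    using op by (auto simp: smooth_on_def intro: Ck_on_subset)
  have Q_eq: "\<forall>\<^sub>F V in nhds Ve. invertible (M (apart V)) \<and> Q V = matrix_inv (M (apart V))"
    if "Ve \<in> {Vm, Vp}" for Ve
  proof -
    have "filterlim apart (nhds (apart Ve)) (nhds Ve)"
      using linear_continuous_at[OF bounded_linear_apart, of Ve]
      by (simp add: isCont_def tendsto_at_iff_tendsto_nhds)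
    moreover have "\<forall>\<^sub>F a in nhds (apart Ve). h a = 0 \<and> sym_pos_def (M a)"
      using that h0 by blast
    ultimately have "\<forall>\<^sub>F V in nhds Ve. h (apart V) = 0 \<and> sym_pos_def (M (apart V))"
      by (rule eventually_compose_filterlim[rotated])
    then show ?thesis
      by eventually_elim (auto simp: Q_def N_def mat_0 sym_pos_def_invertible)
  qed
  have inv: "\<forall>\<^sub>F V in nhds Ve.
      invertible (hessian (entropy S) V) \<and> A0 V = matrix_inv (hessian (entropy S) V) \<and>
      invertible (hessian (pot S) (apart V)) \<and> Q V = matrix_inv (hessian (pot S) (apart V))"
    if "Ve \<in> {Vm, Vp}" for Ve
    using Q_eq[OF that]
    by eventually_elim (auto simp: hessian_entropy[OF g M] hess A0_def matrix_inv_block)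
  have A: "Dflux S V ** A0 V = block_mat 0 (- mat 1) (- (M (apart V) ** Q V)) 0" for V
  proof -
    have neg: "(- X) ** Y = - (X ** Y)" for X Y :: "real^'n^'n"
      by (simp add: matrix_matrix_mult_def vec_eq_iff sum_negf)
    show ?thesis by (simp add: Dflux A0_def block_mat_mult neg)
  qed
  have A_sym: "symmetric_mat (Dflux S Ve ** A0 Ve)" if "Ve \<in> {Vm, Vp}" for Ve
  proof -
    have "M (apart Ve) ** Q Ve = mat 1"
      using eventually_nhds_x_imp_x[OF Q_eq[OF that]] by (simp add: matrix_inv_right)
    then have "Dflux S Ve ** A0 Ve = block_mat 0 (- mat 1) (- mat 1) 0" by (simp add: A)
    moreover have "transpose (- mat 1 :: real^'n^'n) = - mat 1" "transpose (0 :: real^'n^'n) = 0"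
      by (simp_all add: transpose_def mat_def vec_eq_iff)
    ultimately show ?thesis by (simp add: symmetric_mat_def transpose_block_mat)
  qed
  have "upper_left (Dflux S V ** A0 V) = 0" for V
    by (simp add: A upper_left_def block_mat_def vec_eq_iff)
  then have "symmetric_mat (upper_left (Dflux S V ** A0 V))" for V
    by (simp add: symmetric_mat_def transpose_def vec_eq_iff)
  then have A1: "cond_A1 S A0 Vm Vp"
    using A_sym Q_pd by (simp add: cond_A1_def A0_def sym_pos_def_block)
  have visc_pos: "x \<bullet> (visc S (apart Ve) *v x) > 0" if "Ve \<in> {Vm, Vp}" "x \<noteq> 0" for Ve x
  proof -
    have "apart Ve \<in> adm S"
      using that(1) hyp by (auto simp: strict_hyperbolicity_region_def state_space_def)
    then have "isCont (visc S) (apart Ve)"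
      using visc adm by (simp add: continuous_on_eq_continuous_at)
    moreover have "\<exists>F. ((\<lambda>z. apart (Vbar z)) \<longlongrightarrow> apart Ve) F \<and> F \<noteq> bot"
      using that(1) vis(3,4) bounded_linear.tendsto[OF bounded_linear_apart]
        trivial_limit_at_bot_linorder trivial_limit_at_top_linorder by blast
    ultimately show ?thesis
      using elliptic_at_limit[OF vis(1), of "\<lambda>z. apart (Vbar z)"] vis(2) that(2) by blast
  qed
  have "Bmat S Ve *v v \<noteq> 0" if Ve: "Ve \<in> {Vm, Vp}" and v: "is_eigenvector (Dflux S Ve) l v" for Ve l v
  proof
    assume B: "Bmat S Ve *v v = 0"
    note e = eigenvector_first_order_block[OF v[unfolded Dflux]]
    have "visc S (apart Ve) *v bpart v = 0"
      using arg_cong[OF B, of bpart] by (simp add: Bmat_def bpart_block_mat)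
    then have "bpart v = 0" using visc_pos[OF Ve, of "bpart v"] by force
    then have "l *\<^sub>R apart v = 0" using e(2) by simp
    then have "M (apart Ve) *v apart v = 0" "apart v \<noteq> 0"
      using e(1) by (auto simp: is_eigenvector_def power2_eq_square)
    then show False using pd[OF Ve] unfolding sym_pos_def_def by force
  qed
  then have A2: "cond_A2 S Vm Vp" by (auto simp: cond_A2_def)
  have A3: "cond_A3 S A0 R"
    using vis(1)
    by (simp add: cond_A3_def Bmat_def A0_def block_mat_mult uniformly_elliptic_on_def
        sym_part_quadratic_form)
  show ?thesis
    unfolding symmetrizable_hyperbolic_parabolic_def
    using A0_def A0_smooth Q_pd inv A1 A2 A3 by blast
qed

section \<open>The planar models\<close>

text \<open>The incompressible potentials have \<open>\<kappa> = 0\<close> and \<open>p = 1\<close>; in the compressible ones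
  \<open>\<kappa> = 1\<close>, and \<open>p\<close> is \<open>1\<close> in the transverse directions and \<open>0\<close> in the longitudinal one.\<close>

definition elastic_pot :: "real \<Rightarrow> real^'n \<Rightarrow> real^'n \<Rightarrow> real" where
  "elastic_pot \<kappa> p a = (1/4) * ((norm a)\<^sup>2 - \<kappa>)\<^sup>2 + (1/2) * (a \<bullet> (diag_mat p *v a))"

definition elastic_hess :: "real \<Rightarrow> real^'n \<Rightarrow> real^'n \<Rightarrow> real^'n^'n" where
  "elastic_hess \<kappa> p a = mat ((norm a)\<^sup>2 - \<kappa>) + 2 *\<^sub>R outer a a + diag_mat p"

lemma diag_mat_mult_vector: "(diag_mat p *v x) $ i = p $ i * x $ i"
  by (simp add: diag_mat_def matrix_vector_mult_def if_distrib[of "\<lambda>u. u * _"] cong: if_cong)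

lemma power2_norm_vec: "(norm x)\<^sup>2 = (\<Sum>i\<in>UNIV. (x $ i)\<^sup>2)" for x :: "real^'n"
  unfolding power2_norm_eq_inner inner_vec_def by (simp add: power2_eq_square)

lemma outer_mult_vector: "outer x y *v z = (y \<bullet> z) *\<^sub>R x"
  by (simp add: outer_def matrix_vector_mult_def inner_vec_def vec_eq_iff sum_distrib_left mult_ac)

lemma inner_diag_mat: "x \<bullet> (diag_mat p *v y) = (\<Sum>i\<in>UNIV. p $ i * x $ i * y $ i)"
  by (simp add: inner_vec_def diag_mat_mult_vector mult_ac)

lemma elastic_hess_mult_vector:
  "elastic_hess \<kappa> p a *v h = ((norm a)\<^sup>2 - \<kappa>) *\<^sub>R h + (2 * (a \<bullet> h)) *\<^sub>R a + diag_mat p *v h"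
  by (simp add: elastic_hess_def matrix_vector_mult_add_rdistrib mat_mult_vector outer_mult_vector
      scaleR_matrix_vector_assoc[symmetric])

lemma elastic_pot_has_derivative:
  "(elastic_pot \<kappa> p has_derivative
    (\<lambda>h. (((norm a)\<^sup>2 - \<kappa>) *\<^sub>R a + diag_mat p *v a) \<bullet> h)) (at a)"
proof -
  have d: "((\<lambda>a. diag_mat p *v a) has_derivative (\<lambda>h. diag_mat p *v h)) (at a)"
    by (rule bounded_linear_imp_has_derivative) simp
  have "((\<lambda>a. (1/4) * ((a \<bullet> a - \<kappa>) * (a \<bullet> a - \<kappa>)) + (1/2) * (a \<bullet> (diag_mat p *v a))) has_derivative
    (\<lambda>h. (1/4) * ((a \<bullet> a - \<kappa>) * (a \<bullet> h + h \<bullet> a) + (a \<bullet> h + h \<bullet> a) * (a \<bullet> a - \<kappa>))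
       + (1/2) * (a \<bullet> (diag_mat p *v h) + h \<bullet> (diag_mat p *v a)))) (at a)"
    by (auto intro!: derivative_eq_intros d)
  moreover have "a \<bullet> (diag_mat p *v h) = (diag_mat p *v a) \<bullet> h" for h
    by (simp add: inner_diag_mat inner_commute[of "diag_mat p *v a"] mult_ac)
  then have "(1/4) * ((a \<bullet> a - \<kappa>) * (a \<bullet> h + h \<bullet> a) + (a \<bullet> h + h \<bullet> a) * (a \<bullet> a - \<kappa>))
       + (1/2) * (a \<bullet> (diag_mat p *v h) + h \<bullet> (diag_mat p *v a))
       = ((a \<bullet> a - \<kappa>) *\<^sub>R a + diag_mat p *v a) \<bullet> h" for h
    by (simp add: inner_add_left inner_commute[of h] algebra_simps)
  ultimately show ?thesis
    by (simp add: elastic_pot_def[abs_def] power2_norm_eq_inner power2_eq_square[of "_ - \<kappa>"])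
qed

lemma elastic_gradient_has_derivative:
  "((\<lambda>a. ((norm a)\<^sup>2 - \<kappa>) *\<^sub>R a + diag_mat p *v a) has_derivative
    (\<lambda>h. elastic_hess \<kappa> p a *v h)) (at a)"
proof -
  have d: "((\<lambda>a. diag_mat p *v a) has_derivative (\<lambda>h. diag_mat p *v h)) (at a)"
    by (rule bounded_linear_imp_has_derivative) simp
  have "((\<lambda>a. (a \<bullet> a - \<kappa>) *\<^sub>R a + diag_mat p *v a) has_derivative
    (\<lambda>h. ((a \<bullet> a - \<kappa>) *\<^sub>R h + (a \<bullet> h + h \<bullet> a) *\<^sub>R a) + diag_mat p *v h)) (at a)"
    by (auto intro!: derivative_eq_intros d)
  then show ?thesis
    by (simp add: elastic_hess_mult_vector power2_norm_eq_inner inner_commute)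
qed

lemma elastic_system_symmetrizable:
  fixes S :: "'n::finite planar_system"
  assumes pot: "\<And>a. pot S a = elastic_pot \<kappa> p a" and \<kappa>: "\<kappa> \<le> 1" and p: "\<And>i. p $ i \<ge> 0"
    and adm: "open (adm S)" and visc: "continuous_on (adm S) (visc S)"
    and profile: "admissible_profile S s Vbar Vm Vp R"
  shows "symmetrizable_hyperbolic_parabolic S R Vm Vp"
proof (rule symmetrizable_if_pot_hessian_bounded_below[OF _ elastic_gradient_has_derivative _ _ _ adm visc profile])
  have "pot S = elastic_pot \<kappa> p" using pot by blast
  then show "(pot S has_derivative (\<lambda>h. (((norm a)\<^sup>2 - \<kappa>) *\<^sub>R a + diag_mat p *v a) \<bullet> h)) (at a)" for a
    by (simp only: elastic_pot_has_derivative)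
  show "symmetric_mat (elastic_hess \<kappa> p a)" for a
    by (auto simp: symmetric_mat_def elastic_hess_def transpose_def mat_def outer_def diag_mat_def vec_eq_iff)
  show "- (norm v)\<^sup>2 \<le> v \<bullet> (elastic_hess \<kappa> p a *v v)" for a v
  proof -
    have "v \<bullet> (elastic_hess \<kappa> p a *v v)
        = ((norm a)\<^sup>2 + (1 - \<kappa>)) * (norm v)\<^sup>2 - (norm v)\<^sup>2 + 2 * (a \<bullet> v)\<^sup>2 + (\<Sum>i\<in>UNIV. p $ i * (v $ i)\<^sup>2)"
      by (simp add: elastic_hess_mult_vector inner_add_right inner_diag_mat power2_norm_eq_inner
          inner_commute power2_eq_square[of "a \<bullet> v"] power2_eq_square[of "_ $ _"] algebra_simps)
    moreover have "((norm a)\<^sup>2 + (1 - \<kappa>)) * (norm v)\<^sup>2 \<ge> 0"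
      using \<kappa> by (intro mult_nonneg_nonneg add_nonneg_nonneg) auto
    moreover have "(\<Sum>i\<in>UNIV. p $ i * (v $ i)\<^sup>2) \<ge> 0" using p by (intro sum_nonneg) auto
    ultimately show ?thesis by (smt (verit) zero_le_power2)
  qed
  show "Ck_on k UNIV (elastic_hess \<kappa> p)" for k
  proof (rule Ck_on_matrixI[OF open_UNIV])
    fix i j :: 'n
    have "Ck_on k UNIV (\<lambda>a::real^'n. ((\<Sum>l\<in>UNIV. a $ l * a $ l) + - \<kappa>) * (if i = j then 1 else 0)
        + 2 * (a $ i * a $ j) + diag_mat p $ i $ j)"
      by (intro Ck_on_add Ck_on_mult Ck_on_sum Ck_on_const open_UNIV Ck_on_linear bounded_linear_vec_nth)
    moreover have "elastic_hess \<kappa> p a $ i $ j = ((\<Sum>l\<in>UNIV. a $ l * a $ l) + - \<kappa>) * (if i = j then 1 else 0)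
        + 2 * (a $ i * a $ j) + diag_mat p $ i $ j" for a
      by (simp add: elastic_hess_def mat_def outer_def power2_norm_eq_inner inner_vec_def)
    ultimately show "Ck_on k UNIV (\<lambda>a. elastic_hess \<kappa> p a $ i $ j)" by simp
  qed
qed

lemma continuous_on_outer [continuous_intros]:
  fixes f g :: "'a::topological_space \<Rightarrow> real^'n"
  assumes "continuous_on S f" "continuous_on S g"
  shows "continuous_on S (\<lambda>x. outer (f x) (g x))"
  unfolding outer_def by (intro continuous_intros assms)

lemma open_halfspace_pos: "open {a :: real^'n. a $ i > 0}"
  by (simp add: open_halfspace_component_gt_cart)

lemma systems_n3_symmetrizable:
  assumes "S \<in> systems_n3" "admissible_profile S s Vbar Vm Vp R"
  shows "symmetrizable_hyperbolic_parabolic S R Vm Vp"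
proof (rule elastic_system_symmetrizable[where \<kappa> = 1 and p = "vector [1, 1, 0]", OF _ _ _ _ _ assms(2)])
  show "pot S a = elastic_pot 1 (vector [1, 1, 0]) a" for a
    using assms(1) by (auto simp: systems_n3_def W_3D_comp_def elastic_pot_def inner_diag_mat
        sum_3 power2_eq_square)
  show "open (adm S)" using assms(1) by (auto simp: systems_n3_def open_halfspace_pos)
  show "continuous_on (adm S) (visc S)"
    using assms(1) unfolding systems_n3_def
    by (auto simp: B_3D_comp_1_def[abs_def] B_3D_comp_2_def[abs_def] intro!: continuous_intros)
  show "0 \<le> (vector [1, 1, 0] :: real^3) $ i" for i using exhaust_3[of i] by auto
qed simp

lemma systems_n2_symmetrizable:
  assumes "S \<in> systems_n2" "admissible_profile S s Vbar Vm Vp R"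
  shows "symmetrizable_hyperbolic_parabolic S R Vm Vp"
proof -
  have op: "open (adm S)" using assms(1) by (auto simp: systems_n2_def open_halfspace_pos)
  have visc: "continuous_on (adm S) (visc S)"
    using assms(1) unfolding systems_n2_def
    by (auto simp: B_2D_shear_1_def[abs_def] B_2D_shear_2_def[abs_def] B_2D_comp_1_def[abs_def]
        B_2D_comp_2_def[abs_def] intro!: continuous_intros)
  consider (shear) "pot S = W_2D_shear" | (comp) "pot S = W_2D_comp"
    using assms(1) by (auto simp: systems_n2_def)
  then show ?thesis
  proof cases
    case shear
    show ?thesis
    proof (rule elastic_system_symmetrizable[where \<kappa> = 0 and p = 1, OF _ _ _ op visc assms(2)])
      show "pot S a = elastic_pot 0 1 a" for a
      proof -
        have "a \<bullet> (diag_mat 1 *v a) = (norm a)\<^sup>2"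
          by (simp add: inner_diag_mat power2_norm_vec power2_eq_square[of "_ $ _"])
        then show ?thesis by (simp add: shear W_2D_shear_def elastic_pot_def flip: power_mult)
      qed
    qed auto
  next
    case comp
    show ?thesis
    proof (rule elastic_system_symmetrizable[where \<kappa> = 1 and p = "vector [1, 0]", OF _ _ _ op visc assms(2)])
      show "pot S a = elastic_pot 1 (vector [1, 0]) a" for a
        by (simp add: comp W_2D_comp_def elastic_pot_def inner_diag_mat sum_2 power2_eq_square)
      show "0 \<le> (vector [1, 0] :: real^2) $ i" for i using exhaust_2[of i] by auto
    qed simp
  qed
qed

lemma systems_n1_symmetrizable:
  assumes "S \<in> systems_n1" "admissible_profile S s Vbar Vm Vp R"
  shows "symmetrizable_hyperbolic_parabolic S R Vm Vp"
proof -
  have op: "open (adm S)" using assms(1) by (auto simp: systems_n1_def open_halfspace_pos)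
  have mat_scaleR: "mat c = c *\<^sub>R (mat 1 :: real^1^1)" for c by (simp add: mat_def vec_eq_iff)
  have visc: "continuous_on (adm S) (visc S)"
    using assms(1) unfolding systems_n1_def
    by (auto simp: B_1D_trans_def[abs_def] B_1D_comp_def[abs_def] mat_scaleR[of "_ / _"]
        intro!: continuous_intros)
  have norm1: "(norm a)\<^sup>2 = (a $ 1)\<^sup>2" for a :: "real^1"
    by (simp add: power2_norm_vec sum_1)
  consider (trans) "pot S = W_1D_trans" | (comp) "pot S = W_1D_comp"
    using assms(1) by (auto simp: systems_n1_def)
  then show ?thesis
  proof cases
    case trans
    show ?thesis
    proof (rule elastic_system_symmetrizable[where \<kappa> = 0 and p = 1, OF _ _ _ op visc assms(2)])
      show "pot S a = elastic_pot 0 1 a" for a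
        by (simp add: trans W_1D_trans_def elastic_pot_def inner_diag_mat norm1 sum_1
            flip: power2_eq_square power_mult)
    qed auto
  next
    case comp
    show ?thesis
      by (rule elastic_system_symmetrizable[where \<kappa> = 1 and p = 0, OF _ _ _ op visc assms(2)])
         (auto simp: comp W_1D_comp_def elastic_pot_def inner_diag_mat norm1)
  qed
qed

lemma B_3D_comp_2_elliptic:
  assumes "C > 0"
  shows "uniformly_elliptic_on {a. 0 < a$3 \<and> a$3 < C} B_3D_comp_2"
  unfolding uniformly_elliptic_on_def
proof (intro exI[of _ "1 / C"] conjI ballI allI)
  show "1 / C > 0" using assms by simp
  fix a x :: "real^3" assume a: "a \<in> {a. 0 < a$3 \<and> a$3 < C}"
  have "1 / C * (norm x)\<^sup>2 \<le> 1 / a$3 * (norm x)\<^sup>2"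
    using a by (intro mult_right_mono) (auto simp: frac_le)
  also have "\<dots> \<le> 1 / a$3 * (x \<bullet> (diag_mat (vector [1, 1, 2]) *v x))"
    using a by (intro mult_left_mono) (auto simp: inner_diag_mat power2_norm_vec sum_3 power2_eq_square[of "_ $ _"])
  also have "\<dots> = x \<bullet> (B_3D_comp_2 a *v x)"
    by (simp add: B_3D_comp_2_def scaleR_matrix_vector_assoc[symmetric])
  finally show "1 / C * (norm x)\<^sup>2 \<le> x \<bullet> (B_3D_comp_2 a *v x)" .
qed

text \<open>Here \<open>B\<^sub>0\<close> controls \<open>w = x\<^sub>1\<^sup>2 + x\<^sub>2\<^sup>2\<close> and \<open>y = a \<bullet> x\<close>, so \<open>x\<^sub>3\<close> is recovered from
  \<open>a\<^sub>3 x\<^sub>3 = y - (a\<^sub>1 x\<^sub>1 + a\<^sub>2 x\<^sub>2)\<close>. Squaring costs a factor \<open>1 + a\<^sub>1\<^sup>2 + a\<^sub>2\<^sup>2\<close>, which the hypothesis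
  on \<open>a\<^sub>3\<^sup>2\<close> absorbs uniformly in \<open>a\<close>.\<close>

lemma B_3D_comp_1_elliptic:
  assumes c: "c > 0"
  shows "uniformly_elliptic_on {a. (a$3)\<^sup>2 > c * (1 + (a$1)\<^sup>2 + (a$2)\<^sup>2)} B_3D_comp_1"
  unfolding uniformly_elliptic_on_def
proof (intro exI[of _ "c / (c + 2)"] conjI ballI allI)
  show "c / (c + 2) > 0" using c by simp
  fix a x :: "real^3" assume "a \<in> {a. (a$3)\<^sup>2 > c * (1 + (a$1)\<^sup>2 + (a$2)\<^sup>2)}"
  then have a: "c * (1 + (a$1)\<^sup>2 + (a$2)\<^sup>2) < (a$3)\<^sup>2" by simp
  define w where "w = (x$1)\<^sup>2 + (x$2)\<^sup>2"
  define \<alpha> where "\<alpha> = (a$1)\<^sup>2 + (a$2)\<^sup>2"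
  define m where "m = a$1 * x$1 + a$2 * x$2"
  define y where "y = a \<bullet> x"
  have y: "y = m + a$3 * x$3" by (simp add: y_def m_def inner_vec_def sum_3)
  have B: "x \<bullet> (B_3D_comp_1 a *v x) = w + 2 * y\<^sup>2"
    by (simp add: B_3D_comp_1_def matrix_vector_mult_add_rdistrib outer_mult_vector inner_add_right
        inner_diag_mat sum_3 w_def y_def scaleR_matrix_vector_assoc[symmetric] inner_commute
        power2_eq_square)
  have n: "(norm x)\<^sup>2 = w + (x$3)\<^sup>2"
    by (simp add: power2_norm_vec sum_3 w_def)
  have \<alpha>: "\<alpha> \<ge> 0" and w: "w \<ge> 0" by (simp_all add: \<alpha>_def w_def)
  have m: "m\<^sup>2 \<le> \<alpha> * w"
  proof -
    have "\<alpha> * w - m\<^sup>2 = (a$1 * x$2 - a$2 * x$1)\<^sup>2"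
      by (simp add: \<alpha>_def w_def m_def power2_eq_square algebra_simps)
    then show ?thesis by (smt (verit) zero_le_power2)
  qed
  have "(a$3 * x$3)\<^sup>2 \<le> 2 * y\<^sup>2 + 2 * m\<^sup>2"
  proof -
    have "2 * y\<^sup>2 + 2 * m\<^sup>2 - (a$3 * x$3)\<^sup>2 = (y + m)\<^sup>2"
      by (simp add: y power2_eq_square algebra_simps)
    then show ?thesis by (smt (verit) zero_le_power2)
  qed
  also have "\<dots> \<le> 2 * y\<^sup>2 + 2 * (\<alpha> * w)" using m by simp
  also have "\<dots> \<le> (1 + \<alpha>) * (2 * y\<^sup>2 + 2 * w)"
    using \<alpha> w by (simp add: algebra_simps)
  finally have 1: "(a$3)\<^sup>2 * (x$3)\<^sup>2 \<le> (1 + \<alpha>) * (2 * y\<^sup>2 + 2 * w)" by (simp add: power_mult_distrib)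
  have "c * (1 + \<alpha>) * (x$3)\<^sup>2 \<le> (a$3)\<^sup>2 * (x$3)\<^sup>2"
    using a by (intro mult_right_mono) (auto simp: \<alpha>_def add.assoc)
  with 1 have "(1 + \<alpha>) * (c * (x$3)\<^sup>2) \<le> (1 + \<alpha>) * (2 * y\<^sup>2 + 2 * w)" by (simp add: mult_ac)
  then have "c * (x$3)\<^sup>2 \<le> 2 * y\<^sup>2 + 2 * w" using \<alpha> by simp
  moreover have "0 \<le> (2 + 2 * c) * y\<^sup>2" using c by simp
  ultimately have "c * (w + (x$3)\<^sup>2) \<le> (c + 2) * (w + 2 * y\<^sup>2)"
    by (simp add: algebra_simps)
  then show "c / (c + 2) * (norm x)\<^sup>2 \<le> x \<bullet> (B_3D_comp_1 a *v x)"
    using c by (simp add: B n field_simps)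
qed

theorem mainTheorem1:
  shows "(\<forall>S\<in>systems_n3. \<forall>s Vbar Vm Vp R. admissible_profile S s Vbar Vm Vp R \<longrightarrow>
            symmetrizable_hyperbolic_parabolic S R Vm Vp)
       \<and> (\<forall>S\<in>systems_n2. \<forall>s Vbar Vm Vp R. admissible_profile S s Vbar Vm Vp R \<longrightarrow>
            symmetrizable_hyperbolic_parabolic S R Vm Vp)
       \<and> (\<forall>S\<in>systems_n1. \<forall>s Vbar Vm Vp R. admissible_profile S s Vbar Vm Vp R \<longrightarrow>
            symmetrizable_hyperbolic_parabolic S R Vm Vp)
       \<and> (\<forall>C>0. uniformly_elliptic_on {a. 0 < a$3 \<and> a$3 < C} B_3D_comp_2)
       \<and> (\<forall>c>0. uniformly_elliptic_on {a. (a$3)\<^sup>2 > c * (1 + (a$1)\<^sup>2 + (a$2)\<^sup>2)} B_3D_comp_1)"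
  using systems_n3_symmetrizable systems_n2_symmetrizable systems_n1_symmetrizable
    B_3D_comp_2_elliptic B_3D_comp_1_elliptic by blast

end
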